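(* For every element $g\in\mathcal G$ of infinite order, the translation length satisfies $\tau(g)\ge \frac{1}{2\delta}$, where $\delta$ is the word length of $\Delta$.
   Context: Let $\mathcal A$ be an Artin group of finite type with generating set $S$ and associated finite Coxeter group $\mathcal W$; $\mathcal A^+$ is the submonoid generated by $S$, and $x<y$ means $y=xz$ with $z\in\mathcal A^+$. An atom is an element of $\mathcal A^+$ whose $S$-word length equals the length of its image in $\mathcal W$; $\Delta$ is the atom mapping to the longest element of $\mathcal W$ ($\Delta^2$ central). For $g\in\mathcal A^+$, $\alpha(g)$ is the largest (for $<$) atom with $\alpha(g)<g$; the normal form of $g$ is $g=A_1\cdot\ldots\cdot A_k$ with nontrivial atoms and $A_i=\alpha(A_i\cdots A_k)$. Let $\mathcal G=\mathcal A/\langle\Delta^2\rangle$ act on $V=\mathcal A/\langle\Delta\rangle$ by left multiplication, $*=\langle\Delta\rangle$. Each $v\in V$ has a unique special representative in $\mathcal A^+$ whose normal form contains no $\Delta$; its word length is the wordnorm $\|v\|$. The translation length of $g\in\mathcal G$ is $\tau(g)=\lim_{n\to\infty}\|g^n( * )\|/n$. *)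

theory Defs
  imports Complex_Main
begin

text \<open>Coxeter matrix on a finite generating set S (off-diagonal entries finite, as forced
by finite type). Words in the Artin group are lists of letters (s, True) = s and
(s, False) = s inverse.\<close>

definition coxeter_matrix :: "'a set \<Rightarrow> ('a \<Rightarrow> 'a \<Rightarrow> nat) \<Rightarrow> bool" where
  "coxeter_matrix S m \<longleftrightarrow> (\<forall>s\<in>S. \<forall>t\<in>S. m s t = m t s \<and> m s s = 1 \<and> (s \<noteq> t \<longrightarrow> m s t \<ge> 2))"

definition alt :: "'a \<Rightarrow> 'a \<Rightarrow> nat \<Rightarrow> 'a list" where
  "alt s t n = map (\<lambda>i. if even i then s else t) [0..<n]"

definition pos :: "'a list \<Rightarrow> ('a \<times> bool) list" where
  "pos w = map (\<lambda>s. (s, True)) w"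

definition awords :: "'a set \<Rightarrow> ('a \<times> bool) list set" where
  "awords S = {w. \<forall>x\<in>set w. fst x \<in> S}"

inductive artin_eq :: "'a set \<Rightarrow> ('a \<Rightarrow> 'a \<Rightarrow> nat) \<Rightarrow> ('a \<times> bool) list \<Rightarrow> ('a \<times> bool) list \<Rightarrow> bool"
  for S m where
  refl: "artin_eq S m w w"
| sym: "artin_eq S m u w \<Longrightarrow> artin_eq S m w u"
| trans: "artin_eq S m u v \<Longrightarrow> artin_eq S m v w \<Longrightarrow> artin_eq S m u w"
| free: "s \<in> S \<Longrightarrow> artin_eq S m (u @ [(s, b), (s, \<not> b)] @ w) (u @ w)"
| braid: "s \<in> S \<Longrightarrow> t \<in> S \<Longrightarrow> s \<noteq> t \<Longrightarrow>
     artin_eq S m (u @ pos (alt s t (m s t)) @ w) (u @ pos (alt t s (m s t)) @ w)"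

inductive cox_eq :: "'a set \<Rightarrow> ('a \<Rightarrow> 'a \<Rightarrow> nat) \<Rightarrow> 'a list \<Rightarrow> 'a list \<Rightarrow> bool"
  for S m where
  refl: "cox_eq S m w w"
| sym: "cox_eq S m u w \<Longrightarrow> cox_eq S m w u"
| trans: "cox_eq S m u v \<Longrightarrow> cox_eq S m v w \<Longrightarrow> cox_eq S m u w"
| sq: "s \<in> S \<Longrightarrow> cox_eq S m (u @ [s, s] @ w) (u @ w)"
| braid: "s \<in> S \<Longrightarrow> t \<in> S \<Longrightarrow> s \<noteq> t \<Longrightarrow>
     cox_eq S m (u @ alt s t (m s t) @ w) (u @ alt t s (m s t) @ w)"

definition cox_length :: "'a set \<Rightarrow> ('a \<Rightarrow> 'a \<Rightarrow> nat) \<Rightarrow> 'a list \<Rightarrow> nat" where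
  "cox_length S m w = (LEAST n. \<exists>v\<in>lists S. cox_eq S m v w \<and> length v = n)"

definition finite_type :: "'a set \<Rightarrow> ('a \<Rightarrow> 'a \<Rightarrow> nat) \<Rightarrow> bool" where
  "finite_type S m \<longleftrightarrow> finite (lists S // {(v, w). v \<in> lists S \<and> w \<in> lists S \<and> cox_eq S m v w})"

definition apref :: "'a set \<Rightarrow> ('a \<Rightarrow> 'a \<Rightarrow> nat) \<Rightarrow> 'a list \<Rightarrow> 'a list \<Rightarrow> bool" where
  "apref S m x y \<longleftrightarrow> (\<exists>z\<in>lists S. artin_eq S m (pos y) (pos (x @ z)))"

definition atom :: "'a set \<Rightarrow> ('a \<Rightarrow> 'a \<Rightarrow> nat) \<Rightarrow> 'a list \<Rightarrow> bool" where
  "atom S m x \<longleftrightarrow> x \<in> lists S \<and> length x = cox_length S m x"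

definition is_alpha :: "'a set \<Rightarrow> ('a \<Rightarrow> 'a \<Rightarrow> nat) \<Rightarrow> 'a list \<Rightarrow> 'a list \<Rightarrow> bool" where
  "is_alpha S m a g \<longleftrightarrow> atom S m a \<and> apref S m a g \<and>
     (\<forall>b. atom S m b \<and> apref S m b g \<longrightarrow> apref S m b a)"

definition is_Delta :: "'a set \<Rightarrow> ('a \<Rightarrow> 'a \<Rightarrow> nat) \<Rightarrow> 'a list \<Rightarrow> bool" where
  "is_Delta S m d \<longleftrightarrow> atom S m d \<and> (\<forall>w\<in>lists S. cox_length S m w \<le> cox_length S m d)"

definition normal_form :: "'a set \<Rightarrow> ('a \<Rightarrow> 'a \<Rightarrow> nat) \<Rightarrow> 'a list list \<Rightarrow> 'a list \<Rightarrow> bool" where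
  "normal_form S m As g \<longleftrightarrow>
     (\<forall>A\<in>set As. atom S m A \<and> \<not> artin_eq S m (pos A) []) \<and>
     artin_eq S m (pos (concat As)) (pos g) \<and>
     (\<forall>i<length As. is_alpha S m (As ! i) (concat (drop i As)))"

definition winv :: "('a \<times> bool) list \<Rightarrow> ('a \<times> bool) list" where
  "winv w = rev (map (\<lambda>(s, b). (s, \<not> b)) w)"

definition wpow :: "('a \<times> bool) list \<Rightarrow> int \<Rightarrow> ('a \<times> bool) list" where
  "wpow w k = (if k \<ge> 0 then concat (replicate (nat k) w) else concat (replicate (nat (- k)) (winv w)))"

text \<open>p is the special representative of the coset x<Delta> in V = A/<Delta>.\<close>
definition special :: "'a set \<Rightarrow> ('a \<Rightarrow> 'a \<Rightarrow> nat) \<Rightarrow> 'a list \<Rightarrow> 'a list \<Rightarrow> ('a \<times> bool) list \<Rightarrow> bool" where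
  "special S m d p x \<longleftrightarrow> p \<in> lists S \<and>
     (\<exists>k::int. artin_eq S m (pos p) (x @ wpow (pos d) k)) \<and>
     (\<exists>As. normal_form S m As p \<and> (\<forall>A\<in>set As. \<not> artin_eq S m (pos A) (pos d)))"

definition wordnorm :: "'a set \<Rightarrow> ('a \<Rightarrow> 'a \<Rightarrow> nat) \<Rightarrow> 'a list \<Rightarrow> ('a \<times> bool) list \<Rightarrow> nat" where
  "wordnorm S m d x = (THE n. \<exists>p. special S m d p x \<and> length p = n)"

text \<open>Translation length of g = a<Delta^2> in G: g^n(*) = a^n <Delta>.\<close>
definition translation_length :: "'a set \<Rightarrow> ('a \<Rightarrow> 'a \<Rightarrow> nat) \<Rightarrow> 'a list \<Rightarrow> ('a \<times> bool) list \<Rightarrow> real" where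
  "translation_length S m d a = lim (\<lambda>n. real (wordnorm S m d (concat (replicate n a))) / real n)"

text \<open>a<Delta^2> has infinite order in G = A/<Delta^2>.\<close>
definition infinite_order_G :: "'a set \<Rightarrow> ('a \<Rightarrow> 'a \<Rightarrow> nat) \<Rightarrow> 'a list \<Rightarrow> ('a \<times> bool) list \<Rightarrow> bool" where
  "infinite_order_G S m d a \<longleftrightarrow>
     (\<forall>n>0. \<forall>k::int. \<not> artin_eq S m (concat (replicate n a)) (wpow (pos d) (2 * k)))"

end

theory Submission
  imports Defs
begin

text \<open>
  Exponent sum and the largest power of \<open>\<Delta>\<close> dividing an element give
  \<open>\<parallel>x\<parallel> = deg x - \<delta> inf x\<close>, which is subadditive. Given \<open>g\<close>, the element
  \<open>c = g\<^sup>2\<^sup>\<delta>\<Delta>\<^sup>-\<^sup>2\<^sup>D\<close> with \<open>D = deg g\<close> has degree 0, and \<open>c \<noteq> 1\<close> if \<open>g\<close> has infinite order.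
  In the lattice order of the Garside group the meets \<open>y\<^sub>k = 1 \<sqinter> c \<sqinter> \<dots> \<sqinter> c\<^sup>k\<close> satisfy
  \<open>y\<^sub>k\<^sub>+\<^sub>1 = 1 \<sqinter> c y\<^sub>k \<le> y\<^sub>k\<close>; since \<open>c\<close> has degree 0, equality would force \<open>c y\<^sub>k = y\<^sub>k\<close>.
  Hence \<open>deg y\<^sub>k \<le> -k\<close>. If \<open>\<Delta>\<^sup>-\<^sup>r \<le> c\<^sup>i\<close> for all \<open>i \<le> k\<close>, then \<open>\<Delta>\<^sup>-\<^sup>r \<le> y\<^sub>k\<close> and so
  \<open>r \<delta> \<ge> k\<close>; that is, \<open>\<parallel>c\<^sup>i\<parallel> \<ge> k\<close> for some \<open>i \<le> k\<close>. So \<open>c\<close> has translation length at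
  least 1, and \<open>g\<close> at least \<open>1/(2\<delta>)\<close>.

  The Garside structure rests on Coxeter groups: the dual geometric representation shows that the
  dihedral words are reduced, the parity of inverted reflections gives the exchange property,
  hence Matsumoto's theorem, and the cube condition in the positive monoid is checked on
  reduced words, all of which divide \<open>\<Delta>\<close>.
\<close>

section \<open>Alternating words\<close>

lemma length_alt [simp]: "length (alt s t n) = n"
  by (simp add: alt_def)

lemma alt_0 [simp]: "alt s t 0 = []"
  by (simp add: alt_def)

lemma nth_alt: "i < n \<Longrightarrow> alt s t n ! i = (if even i then s else t)"
  by (simp add: alt_def)

lemma alt_snoc: "alt s t (Suc n) = alt s t n @ [if even n then s else t]"
  by (simp add: alt_def)

lemma alt_Suc: "alt s t (Suc n) = s # alt t s n"
  by (intro nth_equalityI) (auto simp: nth_alt nth_Cons split: nat.split)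

lemma take_alt: "k \<le> n \<Longrightarrow> take k (alt s t n) = alt s t k"
  by (simp add: alt_def take_map)

text \<open>Read backwards, the tail is again an alternating word, starting at the last letter of
  the whole word. Hence a conjugate of a letter by an alternating word is an alternating word of odd
  length, the form in which dihedral reflections appear below.\<close>

lemma alt_split:
  "alt s t (i + j) = alt s t i @ rev (if even (i + j) then alt t s j else alt s t j)"
proof (rule nth_equalityI)
  fix k assume "k < length (alt s t (i + j))"
  then have k: "k < i + j" by simp
  show "alt s t (i + j) ! k =
      (alt s t i @ rev (if even (i + j) then alt t s j else alt s t j)) ! k"
  proof (cases "k < i")
    case True
    then show ?thesis using k by (simp add: nth_append nth_alt)
  next
    case False
    define l where "l = j - Suc (k - i)"
    have l: "l < j" "i + j = Suc (k + l)" using k False by (auto simp: l_def)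
    have "even (i + j) \<longleftrightarrow> (even k \<longleftrightarrow> odd l)" unfolding l(2) by auto
    moreover have "(alt s t i @ rev (if even (i + j) then alt t s j else alt s t j)) ! k =
        (if even (i + j) then alt t s j else alt s t j) ! l"
      using k False by (simp add: nth_append rev_nth l_def)
    ultimately show ?thesis using k l(1) by (simp add: nth_alt)
  qed
qed simp

lemma rev_alt: "rev (alt s t n) = (if even n then alt t s n else alt s t n)"
  using alt_split[of t s 0 n] alt_split[of s t 0 n] by (auto split: if_splits)

lemma alt_in_lists: "s \<in> S \<Longrightarrow> t \<in> S \<Longrightarrow> alt s t n \<in> lists S"
  by (auto simp: alt_def in_lists_conv_set)

locale coxeter =
  fixes S :: "'a set" and m :: "'a \<Rightarrow> 'a \<Rightarrow> nat"
  assumes coxeter_matrix: "coxeter_matrix S m"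
begin

abbreviation ceq :: "'a list \<Rightarrow> 'a list \<Rightarrow> bool" (infix \<open>\<approx>\<close> 50) where
  "u \<approx> v \<equiv> cox_eq S m u v"

lemma m_sym: "s \<in> S \<Longrightarrow> t \<in> S \<Longrightarrow> m t s = m s t"
  using coxeter_matrix unfolding coxeter_matrix_def by metis

lemma m_ge2: "s \<in> S \<Longrightarrow> t \<in> S \<Longrightarrow> s \<noteq> t \<Longrightarrow> m s t \<ge> 2"
  using coxeter_matrix unfolding coxeter_matrix_def by metis

section \<open>Coxeter equivalence\<close>

lemma ceq_context: "u \<approx> v \<Longrightarrow> x @ u @ y \<approx> x @ v @ y"
proof (induction rule: cox_eq.induct)
  case (sq s u w)
  then show ?case using cox_eq.sq[of s S m "x @ u" "w @ y"] by simp
next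
  case (braid s t u w)
  then show ?case using cox_eq.braid[of s S t m "x @ u" "w @ y"] by simp
qed (auto intro: cox_eq.intros)

lemma ceq_append: "u \<approx> v \<Longrightarrow> x \<approx> y \<Longrightarrow> u @ x \<approx> v @ y"
  using ceq_context[of u v "[]" x] ceq_context[of x y v "[]"] by (auto intro: cox_eq.trans)

lemma ceq_appendL: "x \<approx> y \<Longrightarrow> u @ x \<approx> u @ y"
  by (simp add: ceq_append cox_eq.refl)

lemma ceq_appendR: "x \<approx> y \<Longrightarrow> x @ u \<approx> y @ u"
  by (simp add: ceq_append cox_eq.refl)

lemma ceq_Cons: "x \<approx> y \<Longrightarrow> s # x \<approx> s # y"
  using ceq_appendL[of x y "[s]"] by simp

lemma ceq_even: "u \<approx> v \<Longrightarrow> even (length u) = even (length v)"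
  by (induction rule: cox_eq.induct) auto

lemma ceq_lists: "u \<approx> v \<Longrightarrow> u \<in> lists S \<longleftrightarrow> v \<in> lists S"
  by (induction rule: cox_eq.induct) (auto simp: alt_in_lists)

lemma ceq_rev: "u \<approx> v \<Longrightarrow> rev u \<approx> rev v"
proof (induction rule: cox_eq.induct)
  case (sq s u w)
  then show ?case using cox_eq.sq[of s S m "rev w" "rev u"] by simp
next
  case (braid s t u w)
  then show ?case
    using cox_eq.braid[of s S t m "rev w" "rev u"] cox_eq.sym[OF cox_eq.braid[of s S t m "rev w" "rev u"]]
    by (auto simp: rev_alt)
qed (auto intro: cox_eq.intros)

lemma ceq_inv: "u \<in> lists S \<Longrightarrow> u @ rev u \<approx> []"
proof (induction u)
  case (Cons s u)
  then have "[s] @ (u @ rev u) @ [s] \<approx> [s] @ [] @ [s]" by (intro ceq_context) auto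
  moreover have "[s, s] \<approx> []" using cox_eq.sq[of s S m "[]" "[]"] Cons.prems by simp
  ultimately show ?case by (auto intro: cox_eq.trans)
qed (auto intro: cox_eq.refl)

lemma ceq_inv': "u \<in> lists S \<Longrightarrow> rev u @ u \<approx> []"
  using ceq_inv[of "rev u"] by (simp add: in_lists_conv_set)

lemma ceq_cancelL: "x @ u \<approx> x @ v \<Longrightarrow> x \<in> lists S \<Longrightarrow> u \<approx> v"
proof -
  assume x: "x \<in> lists S" and "x @ u \<approx> x @ v"
  then have 1: "(rev x @ x) @ u \<approx> (rev x @ x) @ v" using ceq_appendL[of _ _ "rev x"] by simp
  have "(rev x @ x) @ w \<approx> w" for w using ceq_appendR[OF ceq_inv'[OF x], of w] by simp
  with 1 show ?thesis by (blast intro: cox_eq.trans cox_eq.sym)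
qed

lemma ceq_cancelR: "u @ x \<approx> v @ x \<Longrightarrow> x \<in> lists S \<Longrightarrow> u \<approx> v"
  using ceq_cancelL[of "rev x" "rev u" "rev v"] ceq_rev[of "u @ x" "v @ x"] ceq_rev[of "rev u" "rev v"]
  by (auto simp: in_lists_conv_set)

text \<open>Letters are involutions, so \<open>rev u\<close> represents the inverse of
  \<open>u\<close>.\<close>

lemma ceq_conjugate_iff:
  assumes "u \<in> lists S"
  shows "x \<approx> rev u @ y @ u \<longleftrightarrow> u @ x @ rev u \<approx> y"
proof
  have *: "(u @ rev u) @ y @ (u @ rev u) \<approx> [] @ y @ []"
    using ceq_append[OF ceq_inv[OF assms] ceq_append[OF cox_eq.refl ceq_inv[OF assms]]] by simp
  {
    assume "x \<approx> rev u @ y @ u"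
    then have "u @ x @ rev u \<approx> u @ (rev u @ y @ u) @ rev u" by (rule ceq_context)
    with * show "u @ x @ rev u \<approx> y" by (auto intro: cox_eq.trans)
  }
  have *: "(rev u @ u) @ x @ (rev u @ u) \<approx> [] @ x @ []"
    using ceq_append[OF ceq_inv'[OF assms] ceq_append[OF cox_eq.refl ceq_inv'[OF assms]]] by simp
  {
    assume "u @ x @ rev u \<approx> y"
    then have "rev u @ (u @ x @ rev u) @ u \<approx> rev u @ y @ u" by (rule ceq_context)
    with * show "x \<approx> rev u @ y @ u" by (auto intro: cox_eq.trans cox_eq.sym)
  }
qed

section \<open>The dual geometric representation\<close>

text \<open>The function \<open>f\<close> records the values of a functional on the simple roots,
  and \<open>act s\<close> composes it with the reflection sending \<alpha>_r to \<alpha>_r - 2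
  B(\<alpha>_s, \<alpha>_r) \<alpha>_s, where B(\<alpha>_s, \<alpha>_r) = - cos(\<pi> / m s r).
  Giving the diagonal value explicitly makes \<open>act s\<close> an involution for every
  \<open>s\<close>, also outside \<open>S\<close>.\<close>

definition act :: "'a \<Rightarrow> ('a \<Rightarrow> real) \<Rightarrow> 'a \<Rightarrow> real" where
  "act s f r = f r + (if r = s then - 2 else 2 * cos (pi / m s r)) * f s"

primrec actw :: "'a list \<Rightarrow> ('a \<Rightarrow> real) \<Rightarrow> 'a \<Rightarrow> real" where
  "actw [] f = f"
| "actw (s # w) f = actw w (act s f)"

lemma actw_append: "actw (u @ v) f = actw v (actw u f)"
  by (induction u arbitrary: f) auto

lemma act_act: "act s (act s f) = f"
  by (rule ext) (simp add: act_def)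

text \<open>The coordinate that the next letter of an alternating word reads satisfies the recurrence
  \<open>v\<^sub>i\<^sub>+\<^sub>2 = 2 cos \<theta> v\<^sub>i\<^sub>+\<^sub>1 - v\<^sub>i\<close>, whence the closed form in sines.\<close>

definition dih :: "real \<Rightarrow> real \<Rightarrow> real \<Rightarrow> nat \<Rightarrow> real" where
  "dih \<theta> x y i = (x * sin (real i * \<theta>) + y * sin ((real i - 1) * \<theta>)) / sin \<theta>"

lemma dih_rec: "dih \<theta> x y (Suc (Suc i)) = 2 * cos \<theta> * dih \<theta> x y (Suc i) - dih \<theta> x y i"
proof -
  have *: "sin (c + 2 * \<theta>) = 2 * cos \<theta> * sin (c + \<theta>) - sin c" for c :: real
  proof -
    have "sin (c + 2 * \<theta>) + sin c = sin ((c + \<theta>) + \<theta>) + sin ((c + \<theta>) - \<theta>)"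
      by (simp add: algebra_simps)
    also have "\<dots> = 2 * cos \<theta> * sin (c + \<theta>)"
      unfolding sin_add sin_diff by simp
    finally show ?thesis by simp
  qed
  have "sin (real (Suc (Suc i)) * \<theta>) = 2 * cos \<theta> * sin (real (Suc i) * \<theta>) - sin (real i * \<theta>)"
    using *[of "real i * \<theta>"] by (simp add: algebra_simps)
  moreover have "sin ((real (Suc (Suc i)) - 1) * \<theta>) =
      2 * cos \<theta> * sin ((real (Suc i) - 1) * \<theta>) - sin ((real i - 1) * \<theta>)"
    using *[of "(real i - 1) * \<theta>"] by (simp add: algebra_simps)
  ultimately show ?thesis
    unfolding dih_def by (simp only:) (simp add: algebra_simps add_divide_distrib diff_divide_distrib)
qed

section \<open>Action of the rank two subgroups\<close>

context
  fixes s t :: 'a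
  assumes st: "s \<in> S" "t \<in> S" "s \<noteq> t"
begin

abbreviation (input) "ang \<equiv> pi / m s t"

lemma sin_ang: "sin ang > 0"
proof -
  have "pi / m s t \<le> pi / 2" using m_ge2[OF st] by (intro divide_left_mono) auto
  also have "\<dots> < pi" by simp
  finally show ?thesis using m_ge2[OF st] by (intro sin_gt_zero) auto
qed

text \<open>The letter about to act reads v_(n+1), while the letter just used carries -v_n because
  its reflection negated that coordinate. One more reflection turns this pair into the next one by
  the recurrence \<open>dih_rec\<close>.\<close>

lemma actw_alt_st:
  "actw (alt s t n) f (if even n then s else t) = dih ang (f s) (f t) (Suc n) \<and>
   actw (alt s t n) f (if even n then t else s) = - dih ang (f s) (f t) n"
proof (induction n)
  case 0
  show ?case using sin_ang by (simp add: dih_def)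
next
  case (Suc n)
  have m: "m t s = m s t" using m_sym st by simp
  show ?case
    using Suc.IH st(3) unfolding alt_snoc actw_append
    by (auto simp: act_def m dih_rec)
qed

text \<open>Each reflection adds to coordinate \<open>r\<close> a fixed multiple of the coordinate
  that it reads, and \<open>actw_alt_st\<close> supplies these readings.\<close>

lemma actw_alt_sum:
  "actw (alt s t n) f r = f r +
     (\<Sum>i<n. (if even i then (if r = s then - 2 else 2 * cos (pi / m s r))
                     else (if r = t then - 2 else 2 * cos (pi / m t r))) * dih ang (f s) (f t) (Suc i))"
proof (induction n)
  case (Suc n)
  then show ?case
    using actw_alt_st[of n f] unfolding alt_snoc actw_append
    by (auto simp: act_def)
qed simp

end

text \<open>This is sin(\<pi> - x) = sin x: run from the far end, the sequence is the one with
  exchanged initial values. It lets both sides of a braid relation be written with the same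
  readings.\<close>

lemma dih_reflect:
  assumes "M > 0" "i \<le> M + 1"
  shows "dih (pi / M) y x i = dih (pi / M) x y (M + 1 - i)"
proof -
  have "sin ((real (M + 1 - i)) * (pi / M)) = sin ((real i - 1) * (pi / M))"
  proof -
    have "real (M + 1 - i) * (pi / M) = pi - (real i - 1) * (pi / M)"
      using assms by (simp add: of_nat_diff field_simps)
    then show ?thesis by simp
  qed
  moreover have "sin ((real (M + 1 - i) - 1) * (pi / M)) = sin (real i * (pi / M))"
  proof -
    have "(real (M + 1 - i) - 1) * (pi / M) = pi - real i * (pi / M)"
      using assms by (simp add: of_nat_diff field_simps)
    then show ?thesis by simp
  qed
  ultimately show ?thesis unfolding dih_def by (simp only: add.commute)
qed

text \<open>Multiplication by 2 cos(\<theta>/2) makes the sum telescope. The boundary terms lie half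
  a period apart, so they have opposite signs and cancel for odd \<open>M\<close>; the factor is
  nonzero since \<theta> < \<pi>.\<close>

lemma alternating_sin_sum:
  assumes "odd M" "M > 1"
  shows "(\<Sum>j<M. (-1) ^ j * sin ((real j + c) * (pi / M))) = 0"
proof -
  define \<theta> where "\<theta> = pi / M"
  define g where "g j = sin ((real j + c - 1/2) * \<theta>)" for j :: nat
  have half: "2 * cos (\<theta> / 2) * sin ((real j + c) * \<theta>) = g (Suc j) + g j" for j
  proof -
    have "g (Suc j) = sin ((real j + c) * \<theta> + \<theta> / 2)" "g j = sin ((real j + c) * \<theta> - \<theta> / 2)"
      unfolding g_def by (auto simp: algebra_simps add_divide_distrib)
    then show ?thesis by (simp add: sin_add sin_diff)
  qed
  have "2 * cos (\<theta> / 2) * (\<Sum>j<n. (-1) ^ j * sin ((real j + c) * \<theta>)) = g 0 - (-1) ^ n * g n" for n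
  proof (induction n)
    case (Suc n)
    then show ?case using half[of n] by (simp add: algebra_simps)
  qed simp
  moreover have "g M = - g 0"
  proof -
    have "(real M + c - 1/2) * \<theta> = (c - 1/2) * \<theta> + pi"
      using assms by (simp add: \<theta>_def field_simps)
    then show ?thesis unfolding g_def by simp
  qed
  ultimately have "2 * cos (\<theta> / 2) * (\<Sum>j<M. (-1) ^ j * sin ((real j + c) * \<theta>)) = 0"
    using assms by simp
  moreover have "cos (\<theta> / 2) > 0"
  proof (rule cos_gt_zero)
    show "0 < \<theta> / 2" using assms by (simp add: \<theta>_def)
    have "\<theta> < pi" using assms by (simp add: \<theta>_def field_simps)
    then show "\<theta> / 2 < pi / 2" by simp
  qed
  ultimately show ?thesis by (simp add: \<theta>_def)
qed

lemma alternating_dih_sum: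
  assumes "odd M" "M > 1"
  shows "(\<Sum>j<M. (-1) ^ j * dih (pi / M) x y (Suc j)) = 0"
proof -
  have "(\<Sum>j<M. (-1) ^ j * dih (pi / M) x y (Suc j)) =
     (x * (\<Sum>j<M. (-1) ^ j * sin ((real j + 1) * (pi / M)))
       + y * (\<Sum>j<M. (-1) ^ j * sin ((real j + 0) * (pi / M)))) / sin (pi / M)"
    by (simp add: dih_def sum_distrib_left sum_divide_distrib flip: sum.distrib)
       (auto intro!: sum.cong simp: algebra_simps add_divide_distrib)
  then show ?thesis using alternating_sin_sum[OF assms, of 1] alternating_sin_sum[OF assms, of 0] by simp
qed

text \<open>By \<open>dih_reflect\<close> both sides add the same values \<open>V\<close> to
  coordinate \<open>r\<close>, in opposite orders. For even \<open>M\<close> the weights agree term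
  by term. For odd \<open>M\<close> the weights of \<open>s\<close> and \<open>t\<close> are
  exchanged, and the difference is a multiple of the alternating sum, which vanishes.\<close>

lemma actw_braid:
  assumes st: "s \<in> S" "t \<in> S" "s \<noteq> t"
  shows "actw (alt s t (m s t)) f = actw (alt t s (m s t)) f"
proof
  fix r
  define M where "M = m s t"
  have M2: "M \<ge> 2" using m_ge2[OF st] by (simp add: M_def)
  have mts: "m t s = M" using m_sym[OF st(1,2)] by (simp add: M_def)
  define k where "k b = (if b then (if r = s then - 2 else 2 * cos (pi / m s r))
                     else (if r = t then - 2 else 2 * cos (pi / m t r)))" for b
  define V where "V = dih (pi / M) (f s) (f t)"
  have 1: "actw (alt s t M) f r = f r + (\<Sum>i<M. k (even i) * V (Suc i))"
    using actw_alt_sum[OF st, of M f r] by (simp add: k_def V_def M_def cong: if_cong)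
  have "actw (alt t s M) f r = f r + (\<Sum>i<M. k (odd i) * dih (pi / M) (f t) (f s) (Suc i))"
    using actw_alt_sum[OF st(2,1) not_sym[OF st(3)], of M f r] mts
    by (simp add: k_def cong: if_cong) (auto intro!: sum.cong)
  also have "(\<Sum>i<M. k (odd i) * dih (pi / M) (f t) (f s) (Suc i)) = (\<Sum>i<M. k (odd i) * V (M - i))"
  proof (rule sum.cong[OF HOL.refl])
    fix i assume "i \<in> {..<M}"
    then show "k (odd i) * dih (pi / M) (f t) (f s) (Suc i) = k (odd i) * V (M - i)"
      using dih_reflect[of M "Suc i" "f t" "f s"] by (simp add: V_def)
  qed
  also have "\<dots> = (\<Sum>j<M. k (odd (M - Suc j)) * V (Suc j))"
    by (subst sum.nat_diff_reindex[symmetric]) (auto intro!: sum.cong simp: Suc_diff_Suc)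
  finally have 2: "actw (alt t s M) f r = f r + (\<Sum>j<M. k (odd (M - Suc j)) * V (Suc j))" .
  have "(\<Sum>i<M. k (even i) * V (Suc i)) = (\<Sum>j<M. k (odd (M - Suc j)) * V (Suc j))"
  proof (cases "even M")
    case True
    have "odd (M - Suc j) \<longleftrightarrow> even j" if "j < M" for j
      using True that even_add[of "M - Suc j" "Suc j"] by auto
    then show ?thesis by (intro sum.cong) auto
  next
    case False
    have parity: "odd (M - Suc j) \<longleftrightarrow> odd j" if "j < M" for j
      using False that even_add[of "M - Suc j" "Suc j"] by auto
    have "(\<Sum>i<M. k (even i) * V (Suc i)) - (\<Sum>j<M. k (odd (M - Suc j)) * V (Suc j)) =
        (\<Sum>j<M. (k True - k False) * ((-1) ^ j * V (Suc j)))"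
      unfolding sum_subtractf[symmetric]
    proof (rule sum.cong[OF HOL.refl])
      fix j assume "j \<in> {..<M}"
      then have "k (odd (M - Suc j)) = k (odd j)" using parity by auto
      then show "k (even j) * V (Suc j) - k (odd (M - Suc j)) * V (Suc j) =
          (k True - k False) * ((-1) ^ j * V (Suc j))"
        by (cases "even j") (simp_all add: algebra_simps)
    qed
    also have "\<dots> = 0"
      using alternating_dih_sum[of M "f s" "f t"] False M2
      by (simp add: V_def flip: sum_distrib_left)
    finally show ?thesis by simp
  qed
  with 1 2 show "actw (alt s t (m s t)) f r = actw (alt t s (m s t)) f r" by (simp add: M_def)
qed

lemma actw_ceq: "u \<approx> v \<Longrightarrow> actw u f = actw v f"
proof (induction arbitrary: f rule: cox_eq.induct)
  case (sq s u w)
  then show ?case by (simp add: actw_append act_act)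
next
  case (braid s t u w)
  then show ?case by (simp only: actw_append actw_braid[OF braid])
qed auto

text \<open>The functional with values sin \<theta> at \<open>s\<close> and 0 elsewhere makes the
  readings sin(i \<theta>). The two words then give one coordinate the values -sin(L \<theta>) and
  sin(L \<theta>), which differ for 0 < L < m.\<close>

lemma alt_not_ceq:
  assumes st: "s \<in> S" "t \<in> S" "s \<noteq> t" and L: "0 < L" "L < m s t"
  shows "\<not> alt s t L \<approx> alt t s L"
proof
  assume "alt s t L \<approx> alt t s L"
  define f where "f r = (if r = s then sin (pi / m s t) else 0)" for r
  have mts: "m t s = m s t" using m_sym[OF st(1,2)] .
  have f: "f s = sin (pi / m s t)" "f t = 0" using st(3) by (auto simp: f_def)
  have nz: "sin (pi / m s t) > 0" by (rule sin_ang[OF st])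
  have "actw (alt s t L) f (if even L then t else s) = - sin (L * (pi / m s t))"
    using actw_alt_st[OF st, of L f] nz by (simp add: f dih_def)
  moreover have "actw (alt t s L) f (if even L then t else s) = sin (L * (pi / m s t))"
    using actw_alt_st[OF st(2,1) not_sym[OF st(3)], of L f] nz by (simp add: f dih_def mts)
  ultimately have "sin (L * (pi / m s t)) = 0"
    using actw_ceq[OF \<open>alt s t L \<approx> alt t s L\<close>, of f] by simp
  moreover have "sin (L * (pi / m s t)) > 0"
  proof (rule sin_gt_zero)
    show "0 < L * (pi / m s t)" using L by simp
    have "L * pi < m s t * pi" using L by simp
    then show "L * (pi / m s t) < pi" using L by (simp add: field_simps)
  qed
  ultimately show False by simp
qed


section \<open>Reflections and the exchange property\<close>

text \<open>\<open>inverts w t\<close>: the reflection \<open>t\<close> occurs an odd number of times among the reflections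
  \<open>s\<^sub>1\<dots>s\<^sub>i\<dots>s\<^sub>1\<close> read off from \<open>w = s\<^sub>1\<dots>s\<^sub>k\<close>.\<close>

primrec inverts :: "'a list \<Rightarrow> 'a list \<Rightarrow> bool" where
  "inverts [] t \<longleftrightarrow> False"
| "inverts (s # w) t \<longleftrightarrow> ([s] \<approx> t) \<noteq> inverts w (s # t @ [s])"

lemma ceq_eq: "t \<approx> t' \<Longrightarrow> x \<approx> t \<longleftrightarrow> x \<approx> t'"
  by (blast intro: cox_eq.trans cox_eq.sym)

lemma inverts_cong: "t \<approx> t' \<Longrightarrow> inverts w t \<longleftrightarrow> inverts w t'"
proof (induction w arbitrary: t t')
  case (Cons s w)
  from Cons.prems have "s # t @ [s] \<approx> s # t' @ [s]"
    using ceq_context[of t t' "[s]" "[s]"] by simp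
  with Cons show ?case using ceq_eq by simp
qed simp

lemma inverts_append: "inverts (u @ v) t \<longleftrightarrow> inverts u t \<noteq> inverts v (rev u @ t @ u)"
  by (induction u arbitrary: t) auto

text \<open>The reflection read off at position \<open>i\<close> is the alternating word of length
  2i + 1, by \<open>alt_split\<close>.\<close>

lemma inverts_alt:
  assumes "s \<in> S" "t \<in> S"
  shows "inverts (alt s t n) x \<longleftrightarrow> odd (card {i \<in> {..<n}. alt s t (2 * i + 1) \<approx> x})"
proof (induction n)
  case (Suc n)
  define c where "c = (if even n then s else t)"
  have "[c] \<approx> rev (alt s t n) @ x @ alt s t n \<longleftrightarrow> alt s t n @ [c] @ rev (alt s t n) \<approx> x"
    using assms by (intro ceq_conjugate_iff alt_in_lists)
  also have "alt s t n @ [c] @ rev (alt s t n) = alt s t (Suc n + n)"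
    using alt_split[of s t "Suc n" n] by (simp add: alt_snoc c_def)
  also have "Suc n + n = 2 * n + 1" by simp
  finally have "inverts (alt s t (Suc n)) x \<longleftrightarrow>
      inverts (alt s t n) x \<noteq> (alt s t (2 * n + 1) \<approx> x)"
    unfolding alt_snoc inverts_append by (simp add: c_def)
  moreover have "{i \<in> {..<Suc n}. alt s t (2 * i + 1) \<approx> x} =
      (if alt s t (2 * n + 1) \<approx> x then {n} else {}) \<union> {i \<in> {..<n}. alt s t (2 * i + 1) \<approx> x}"
    by (auto simp: less_Suc_eq)
  ultimately show ?case using Suc.IH by (auto simp: card_insert_if)
qed simp

text \<open>The alternating word of length 2m is trivial by the braid relation, so an initial piece
  of length \<open>i\<close> is inverse to the remaining piece of length \<open>j\<close>.\<close>

lemma alt_complement: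
  assumes "s \<in> S" "t \<in> S" "s \<noteq> t" "i + j = 2 * m s t"
  shows "alt s t i \<approx> alt t s j"
proof -
  have "alt s t (2 * m s t) = alt s t (m s t) @ rev (alt t s (m s t))"
    using alt_split[of s t "m s t" "m s t"] by (simp add: mult_2)
  moreover have "alt s t (m s t) \<approx> alt t s (m s t)"
    using cox_eq.braid[OF assms(1-3), of m "[]" "[]"] by simp
  ultimately have "alt s t (2 * m s t) \<approx> alt t s (m s t) @ rev (alt t s (m s t))"
    by (simp add: ceq_appendR)
  then have "alt s t (2 * m s t) \<approx> []"
    using ceq_inv[OF alt_in_lists] assms by (blast intro: cox_eq.trans)
  then have "alt s t i @ rev (alt t s j) \<approx> alt t s j @ rev (alt t s j)"
    using alt_split[of s t i j] assms(4) ceq_inv[OF alt_in_lists, of t s j] assms(1,2)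
    by (auto intro: cox_eq.trans cox_eq.sym)
  then show ?thesis
    by (rule ceq_cancelR) (use assms(1,2) alt_in_lists[of t S s j] in \<open>simp add: in_lists_conv_set\<close>)
qed

text \<open>Parity makes \<open>inverts\<close> an invariant of the group element. A square
  \<open>s s\<close> contributes the same reflection twice. The two sides of a braid relation list
  the same reflections in opposite orders: index \<open>i\<close> matches M - 1 - i since (2i + 1) +
  (2(M - 1 - i) + 1) = 2M.\<close>

lemma inverts_ceq: "u \<approx> v \<Longrightarrow> inverts u t \<longleftrightarrow> inverts v t"
proof (induction arbitrary: t rule: cox_eq.induct)
  case (sq s u w)
  have ss: "[s] @ [s] \<approx> []" using cox_eq.sq[OF sq, of m "[]" "[]"] by simp
  have 1: "inverts w (s # s # x @ [s, s]) \<longleftrightarrow> inverts w x" for x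
    using ceq_append[OF ss ceq_append[OF cox_eq.refl[of S m x] ss]] by (intro inverts_cong) simp
  have 2: "[s] \<approx> s # x @ [s] \<longleftrightarrow> [s] \<approx> x" for x
  proof -
    have "[s] @ [s] @ [s] \<approx> [s]" using ceq_appendR[OF ss, of "[s]"] by simp
    then have "[s] @ [s] @ [s] \<approx> x \<longleftrightarrow> [s] \<approx> x" by (blast intro: cox_eq.trans cox_eq.sym)
    then show ?thesis using ceq_conjugate_iff[of "[s]" "[s]" x] sq by simp
  qed
  show ?case using 1[of "rev u @ t @ u"] 2[of "rev u @ t @ u"] by (simp add: inverts_append) blast
next
  case (braid s t u w x)
  define M where "M = m s t"
  have 1: "inverts (alt s t M) y \<longleftrightarrow> inverts (alt t s M) y" for y
  proof -
    have "bij_betw (\<lambda>i. M - Suc i) {i \<in> {..<M}. alt s t (2 * i + 1) \<approx> y}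
        {i \<in> {..<M}. alt t s (2 * i + 1) \<approx> y}"
    proof (rule bij_betw_byWitness[where f' = "\<lambda>i. M - Suc i"])
      have *: "alt a b (2 * i + 1) \<approx> y \<Longrightarrow> alt b a (2 * (M - Suc i) + 1) \<approx> y"
        if "i < M" "{a, b} = {s, t}" for i a b
      proof -
        assume "alt a b (2 * i + 1) \<approx> y"
        moreover have "m a b = M" using that(2) m_sym[OF braid(1,2)] by (auto simp: M_def doubleton_eq_iff)
        then have "alt b a (2 * (M - Suc i) + 1) \<approx> alt a b (2 * i + 1)"
          using that braid alt_complement[of a b "2 * i + 1" "2 * (M - Suc i) + 1"]
          by (auto simp: doubleton_eq_iff intro: cox_eq.sym)
        ultimately show "alt b a (2 * (M - Suc i) + 1) \<approx> y" by (blast intro: cox_eq.trans)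
      qed
      show "(\<lambda>i. M - Suc i) ` {i \<in> {..<M}. alt s t (2 * i + 1) \<approx> y}
          \<subseteq> {i \<in> {..<M}. alt t s (2 * i + 1) \<approx> y}"
        using *[of _ s t] by auto
      show "(\<lambda>i. M - Suc i) ` {i \<in> {..<M}. alt t s (2 * i + 1) \<approx> y}
          \<subseteq> {i \<in> {..<M}. alt s t (2 * i + 1) \<approx> y}"
        using *[of _ t s] by auto
    qed auto
    then show ?thesis using inverts_alt braid(1,2) by (simp add: bij_betw_same_card)
  qed
  have 2: "inverts w (rev (alt s t M) @ y @ alt s t M) \<longleftrightarrow> inverts w (rev (alt t s M) @ y @ alt t s M)" for y
  proof -
    have "alt s t M \<approx> alt t s M" using cox_eq.braid[OF braid, of m "[]" "[]"] by (simp add: M_def)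
    then show ?thesis by (intro inverts_cong ceq_append ceq_rev cox_eq.refl)
  qed
  show ?case
    unfolding M_def[symmetric] inverts_append using 1[of "rev u @ x @ u"] 2[of "rev u @ x @ u"] by simp
qed auto

lemma inverts_decomp:
  "inverts w t \<Longrightarrow> w \<in> lists S \<Longrightarrow> \<exists>x s y. w = x @ s # y \<and> t \<approx> x @ [s] @ rev x"
proof (induction w arbitrary: t)
  case (Cons s w)
  show ?case
  proof (cases "[s] \<approx> t")
    case True
    then show ?thesis by (intro exI[of _ "[]"]) (auto intro: cox_eq.sym)
  next
    case False
    with Cons obtain x r y where w: "w = x @ r # y" and "s # t @ [s] \<approx> x @ [r] @ rev x" by fastforce
    then have "x @ [r] @ rev x \<approx> rev [s] @ t @ [s]" by (simp add: cox_eq.sym)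
    then have "[s] @ (x @ [r] @ rev x) @ rev [s] \<approx> t"
      using ceq_conjugate_iff[of "[s]"] Cons.prems(2) by simp
    with w show ?thesis
      by (intro exI[of _ "s # x"] exI[of _ r] exI[of _ y]) (auto intro: cox_eq.sym)
  qed
qed simp

lemmas ceq_trans [trans] = cox_eq.trans

text \<open>Multiplying by the reflection read off at a letter deletes that letter, because
  \<open>rev x @ x\<close> and the doubled letter cancel.\<close>

lemma inverts_delete:
  assumes "inverts w t" "w \<in> lists S"
  shows "\<exists>x s y. w = x @ s # y \<and> t @ w \<approx> x @ y"
proof -
  obtain x s y where w: "w = x @ s # y" and t: "t \<approx> x @ [s] @ rev x"
    using inverts_decomp[OF assms] by blast
  have "x \<in> lists S" "[s] \<in> lists S" using assms(2) w by auto
  then have "t @ w \<approx> x @ [s] @ (rev x @ x) @ [s] @ y"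
    using ceq_appendR[OF t, of w] by (simp add: w)
  also have "x @ [s] @ (rev x @ x) @ [s] @ y \<approx> x @ [s] @ [] @ [s] @ y"
    using ceq_inv'[OF \<open>x \<in> lists S\<close>] by (intro ceq_append cox_eq.refl)
  also have "x @ [s] @ [] @ [s] @ y \<approx> x @ y"
    using cox_eq.sq[of s S m x y] \<open>[s] \<in> lists S\<close> by simp
  finally show ?thesis using w by blast
qed

text \<open>The contributions of \<open>u\<close> and of \<open>rev u\<close> cancel in parity,
  which leaves the middle letter counted once.\<close>

lemma inverts_self:
  assumes "u \<in> lists S" "s \<in> S"
  shows "inverts (u @ [s] @ rev u) (u @ [s] @ rev u)"
proof -
  let ?t = "u @ [s] @ rev u"
  have 1: "[s] \<approx> rev u @ ?t @ u" using ceq_conjugate_iff[of u "[s]" ?t] assms cox_eq.refl by simp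
  have 2: "rev [s] @ (rev u @ ?t @ u) @ [s] \<approx> [s]"
  proof -
    have "[s] @ [s] @ rev [s] \<approx> rev u @ ?t @ u"
      using 1 cox_eq.sq[of s S m "[s]" "[]"] assms by (auto intro: cox_eq.trans)
    then show ?thesis
      using ceq_conjugate_iff[of "[s]" "[s]" "rev u @ ?t @ u"] assms(2) by (auto intro: cox_eq.sym)
  qed
  have "inverts (rev u @ u) [s] \<longleftrightarrow> inverts [] [s]"
    using assms by (intro inverts_ceq ceq_inv')
  then have "inverts (rev u) [s] \<longleftrightarrow> inverts u ?t" by (simp add: inverts_append)
  moreover have "inverts (rev u) (rev [s] @ (rev u @ ?t @ u) @ [s]) \<longleftrightarrow> inverts (rev u) [s]"
    using 2 by (rule inverts_cong)
  moreover have "inverts [s] (rev u @ ?t @ u)" using 1 by simp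
  ultimately show ?thesis
    using inverts_append[of u "[s] @ rev u" ?t] inverts_append[of "[s]" "rev u" "rev u @ ?t @ u"] by metis
qed

section \<open>Length and reduced words\<close>

abbreviation cl :: "'a list \<Rightarrow> nat" where "cl \<equiv> cox_length S m"

abbreviation red :: "'a list \<Rightarrow> bool" where "red \<equiv> atom S m"

lemma cl_le: "v \<in> lists S \<Longrightarrow> v \<approx> w \<Longrightarrow> cl w \<le> length v"
  unfolding cox_length_def by (rule Least_le) blast

lemma cl_attained:
  assumes "w \<in> lists S"
  shows "\<exists>v\<in>lists S. v \<approx> w \<and> length v = cl w"
proof -
  have "\<exists>v\<in>lists S. v \<approx> w \<and> length v = length w" using assms cox_eq.refl by blast
  then have "\<exists>v\<in>lists S. cox_eq S m v w \<and> length v = (LEAST n. \<exists>v\<in>lists S. v \<approx> w \<and> length v = n)"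
    by (rule LeastI)
  then show ?thesis unfolding cox_length_def .
qed

lemma cl_cong: "u \<approx> v \<Longrightarrow> cl u = cl v"
  unfolding cox_length_def using ceq_eq by presburger

lemma cl_le_length: "w \<in> lists S \<Longrightarrow> cl w \<le> length w"
  by (simp add: cl_le cox_eq.refl)

lemma cl_even: "w \<in> lists S \<Longrightarrow> even (cl w) = even (length w)"
  using cl_attained ceq_even by metis

lemma red_exists: "w \<in> lists S \<Longrightarrow> \<exists>v. red v \<and> v \<approx> w"
  using cl_attained cl_cong unfolding atom_def by metis

lemma red_lists: "red w \<Longrightarrow> w \<in> lists S"
  by (simp add: atom_def)

lemma red_ceq: "red u \<Longrightarrow> u \<approx> v \<Longrightarrow> length u = length v \<Longrightarrow> red v"
  unfolding atom_def using cl_cong ceq_lists by metis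

lemma red_le: "red u \<Longrightarrow> u \<approx> v \<Longrightarrow> length u \<le> length v"
  unfolding atom_def using cl_cong ceq_lists cl_le_length by metis

lemma red_subword: assumes "red (x @ u @ y)" shows "red u"
proof -
  have l: "x \<in> lists S" "u \<in> lists S" "y \<in> lists S" using assms by (auto simp: atom_def)
  then obtain v where v: "v \<in> lists S" "v \<approx> u" "length v = cl u" using cl_attained by blast
  have "length (x @ u @ y) \<le> length (x @ v @ y)"
    using assms ceq_context[OF cox_eq.sym[OF v(2)]] by (rule red_le)
  with v(3) cl_le_length[OF l(2)] l(2) show ?thesis by (simp add: atom_def)
qed

lemma red_appendD: "red (u @ v) \<Longrightarrow> red u \<and> red v"
  using red_subword[of "[]" u v] red_subword[of u v "[]"] by simp

lemma red_ConsD: "red (s # w) \<Longrightarrow> s \<in> S \<and> red w"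
  using red_appendD[of "[s]" w] by (auto simp: atom_def)

lemma red_Nil: "red []"
  using cl_le_length[of "[]"] by (simp add: atom_def)

lemma red_single: "s \<in> S \<Longrightarrow> red [s]"
  using cl_le_length[of "[s]"] cl_even[of "[s]"] by (cases "cl [s]") (auto simp: atom_def)

lemma red_rev: assumes "red w" shows "red (rev w)"
proof -
  have w: "w \<in> lists S" "rev w \<in> lists S" using assms by (auto simp: atom_def in_lists_conv_set)
  then obtain v where v: "v \<in> lists S" "v \<approx> rev w" "length v = cl (rev w)" using cl_attained by blast
  have "w \<approx> rev v" using ceq_rev[OF v(2)] by (simp add: cox_eq.sym)
  then have "length w \<le> length (rev v)" using assms red_le by blast
  with v w cl_le_length[OF w(2)] show ?thesis by (simp add: atom_def)
qed

text \<open>If \<open>w\<close> does not invert \<open>t\<close>, then the product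
  \<open>t @ w\<close> does, since \<open>t\<close> inverts itself. Deleting a letter from a reduced
  word of that product then gives a word for \<open>w\<close>, so \<open>t @ w\<close> has the
  larger length.\<close>

lemma inverts_iff_shorter:
  assumes w: "red w" and t: "t = u @ [s] @ rev u" "u \<in> lists S" "s \<in> S"
  shows "inverts w t \<longleftrightarrow> cl (t @ w) < length w"
proof
  assume "inverts w t"
  then obtain x r y where "w = x @ r # y" "t @ w \<approx> x @ y"
    using inverts_delete w red_lists by blast
  moreover have "x @ y \<in> lists S" using w calculation(1) by (auto simp: atom_def)
  ultimately show "cl (t @ w) < length w" using cl_le[of "x @ y" "t @ w"] cox_eq.sym by fastforce
next
  assume less: "cl (t @ w) < length w"
  show "inverts w t"
  proof (rule ccontr)
    assume "\<not> inverts w t"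
    have tS: "t \<in> lists S" using t by (auto simp: in_lists_conv_set)
    then have "t @ w \<in> lists S" using red_lists[OF w] by simp
    then obtain y where y: "red y" "y \<approx> t @ w" using red_exists by blast
    have tt: "t @ t \<approx> []" using ceq_inv[OF tS] t by simp
    have "inverts w (rev t @ t @ t) \<longleftrightarrow> inverts w t"
      using ceq_appendL[OF tt, of t] t by (intro inverts_cong) simp
    with \<open>\<not> inverts w t\<close> have "inverts (t @ w) t"
      unfolding inverts_append[of t w] using inverts_self[OF t(2,3)] t by simp
    with y have "inverts y t" using inverts_ceq by blast
    then obtain x r z where *: "y = x @ r # z" "t @ y \<approx> x @ z"
      using inverts_delete y red_lists by blast
    have "t @ y \<approx> t @ t @ w" using y(2) by (rule ceq_appendL)
    also have "t @ t @ w \<approx> w" using ceq_appendR[OF tt, of w] by simp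
    finally have "w \<approx> x @ z" using *(2) by (blast intro: cox_eq.trans cox_eq.sym)
    with w have "length w \<le> length (x @ z)" using red_le by blast
    also have "\<dots> < length y" using * by simp
    also have "\<dots> = cl (t @ w)" using y cl_cong by (simp add: atom_def)
    finally show False using less by simp
  qed
qed

lemma exchange:
  assumes "red w" "s \<in> S" "\<not> red (s # w)"
  shows "\<exists>x r y. w = x @ r # y \<and> s # w \<approx> x @ y"
proof -
  have w: "w \<in> lists S" using assms(1) by (simp add: atom_def)
  have "cl (s # w) < length w"
  proof -
    have "cl (s # w) \<noteq> Suc (length w)" using assms w by (auto simp: atom_def)
    moreover have "cl (s # w) \<noteq> length w" using cl_even[of "s # w"] assms w by auto
    moreover have "cl (s # w) \<le> Suc (length w)" using cl_le_length[of "s # w"] assms w by auto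
    ultimately show ?thesis by simp
  qed
  then have "inverts w [s]" using inverts_iff_shorter[of w "[s]" "[]" s] assms by simp
  then show ?thesis using inverts_delete[OF _ w] by force
qed

text \<open>If prepending \<open>s\<close> fails to give a reduced word, exchange deletes some
  letter \<open>r\<close>, and cancelling the common end leaves s # x \<approx> x @ [r]. These are
  the two alternating words of a length below m s t, which \<open>alt_not_ceq\<close>
  separates.\<close>

lemma red_alt: "s \<in> S \<Longrightarrow> t \<in> S \<Longrightarrow> s \<noteq> t \<Longrightarrow> n \<le> m s t \<Longrightarrow> red (alt s t n)"
proof (induction n arbitrary: s t)
  case (Suc n)
  have red: "red (alt t s n)" using Suc m_sym[of s t] by simp
  show ?case
  proof (rule ccontr)
    assume "\<not> red (alt s t (Suc n))"
    then obtain x r y where xry: "alt t s n = x @ r # y" "s # alt t s n \<approx> x @ y"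
      using exchange[OF red Suc.prems(1)] unfolding alt_Suc by blast
    define L where "L = Suc (length x)"
    have L: "L \<le> n" using arg_cong[OF xry(1), of length] by (simp add: L_def)
    have xr: "x = alt t s (length x)" "x @ [r] = alt t s L"
      using take_alt[of "length x" n t s] take_alt[of L n t s] L by (simp_all add: L_def xry(1))
    have "(s # x @ [r]) @ y \<approx> x @ y" using xry by simp
    moreover have lists: "y \<in> lists S" "r \<in> S"
      using red xry(1) by (auto simp: atom_def)
    ultimately have "s # x @ [r] \<approx> x" by (metis ceq_cancelR)
    then have "s # x @ [r] @ [r] \<approx> x @ [r]" using ceq_appendR[of _ _ "[r]"] by fastforce
    moreover have "s # x @ [r] @ [r] \<approx> s # x"
      using cox_eq.sq[of r S m "s # x" "[]"] lists by simp
    ultimately have "s # x \<approx> x @ [r]" by (blast intro: cox_eq.trans cox_eq.sym)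
    moreover have "s # x = alt s t L" using xr(1) alt_Suc[of s t "length x"] by (simp add: L_def)
    ultimately show False
      using alt_not_ceq[of s t L] Suc.prems L xr(2) by (simp add: L_def)
  qed
qed (simp add: red_Nil)

section \<open>The positive monoid and Matsumoto's theorem\<close>

text \<open>Braid moves alone present the Artin monoid. Its embedding into the Artin group is
  established later, in \<open>aeq_pos_iff\<close>.\<close>

inductive bstep :: "'a list \<Rightarrow> 'a list \<Rightarrow> bool" where
  "s \<in> S \<Longrightarrow> t \<in> S \<Longrightarrow> s \<noteq> t \<Longrightarrow> bstep (u @ alt s t (m s t) @ w) (u @ alt t s (m s t) @ w)"

definition peq :: "'a list \<Rightarrow> 'a list \<Rightarrow> bool" (infix \<open>\<sim>\<close> 50) where
  "peq = bstep\<^sup>*\<^sup>*"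

definition dv :: "'a list \<Rightarrow> 'a list \<Rightarrow> bool" (infix \<open>\<unlhd>\<close> 50) where
  "u \<unlhd> w \<longleftrightarrow> (\<exists>z\<in>lists S. u @ z \<sim> w)"

lemma bstep_sym: "bstep u v \<Longrightarrow> bstep v u"
  by (induction rule: bstep.induct) (metis bstep.intros m_sym)

lemma peq_refl [simp]: "u \<sim> u"
  by (simp add: peq_def)

lemma peq_sym: "u \<sim> v \<Longrightarrow> v \<sim> u"
proof -
  have "symp bstep" using bstep_sym by (auto intro: sympI)
  then show "u \<sim> v \<Longrightarrow> v \<sim> u" unfolding peq_def using symp_rtranclp sympD by metis
qed

lemma peq_trans [trans]: "u \<sim> v \<Longrightarrow> v \<sim> w \<Longrightarrow> u \<sim> w"
  unfolding peq_def by (rule rtranclp_trans)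

lemma bstep_context: "bstep u v \<Longrightarrow> bstep (x @ u @ y) (x @ v @ y)"
proof (induction rule: bstep.induct)
  case (1 s t u w)
  then show ?case using bstep.intros[of s t "x @ u" "w @ y"] by simp
qed

lemma peq_context: "u \<sim> v \<Longrightarrow> x @ u @ y \<sim> x @ v @ y"
  unfolding peq_def by (induction rule: rtranclp.induct) (auto intro: bstep_context rtranclp.rtrancl_into_rtrancl)

lemma peq_append: "u \<sim> v \<Longrightarrow> x \<sim> y \<Longrightarrow> u @ x \<sim> v @ y"
  using peq_context[of u v "[]" x] peq_context[of x y v "[]"] by (auto intro: peq_trans)

lemma peq_appendL: "x \<sim> y \<Longrightarrow> u @ x \<sim> u @ y"
  by (simp add: peq_append)

lemma peq_appendR: "x \<sim> y \<Longrightarrow> x @ u \<sim> y @ u"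
  by (simp add: peq_append)

lemma peq_Cons: "x \<sim> y \<Longrightarrow> s # x \<sim> s # y"
  using peq_appendL[of x y "[s]"] by simp

lemma peq_alt: "s \<in> S \<Longrightarrow> t \<in> S \<Longrightarrow> s \<noteq> t \<Longrightarrow> alt s t (m s t) \<sim> alt t s (m s t)"
  using bstep.intros[of s t "[]" "[]"] by (auto simp: peq_def)

lemma peq_ceq: "u \<sim> v \<Longrightarrow> u \<approx> v"
  unfolding peq_def
proof (induction rule: rtranclp.induct)
  case (rtrancl_into_rtrancl a b c)
  from this(2) have "b \<approx> c" by cases (auto intro: cox_eq.braid)
  with rtrancl_into_rtrancl show ?case by (blast intro: cox_eq.trans)
qed (rule cox_eq.refl)

lemma peq_length: "u \<sim> v \<Longrightarrow> length u = length v"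
  unfolding peq_def by (induction rule: rtranclp.induct) (auto elim: bstep.cases)

lemma peq_lists: "u \<sim> v \<Longrightarrow> u \<in> lists S \<longleftrightarrow> v \<in> lists S"
  using ceq_lists peq_ceq by blast

lemma peq_red: "u \<sim> v \<Longrightarrow> red u \<longleftrightarrow> red v"
  using red_ceq peq_ceq peq_length peq_sym by metis

lemma peq_rev: "u \<sim> v \<Longrightarrow> rev u \<sim> rev v"
  unfolding peq_def
proof (induction rule: rtranclp.induct)
  case (rtrancl_into_rtrancl a b c)
  from this(2) have "bstep (rev b) (rev c)"
  proof cases
    case (1 s t u w)
    then show ?thesis
      using bstep.intros[of s t "rev w" "rev u"] bstep_sym[OF bstep.intros[of s t "rev w" "rev u"]]
      by (auto simp: rev_alt)
  qed
  with rtrancl_into_rtrancl show ?case by (blast intro: rtranclp.rtrancl_into_rtrancl)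
qed simp

lemma peq_single: "s \<in> S \<Longrightarrow> [s] \<sim> w \<Longrightarrow> w = [s]"
proof -
  have no_step: "\<not> bstep [s] v" for v
  proof
    assume "bstep [s] v"
    then show False
    proof cases
      case (1 a b u w)
      have "m a b \<le> 1" using arg_cong[OF 1(1), of length]
        by (simp only: length_append length_alt list.size)
      then show False using m_ge2 1 by fastforce
    qed
  qed
  show "[s] \<sim> w \<Longrightarrow> w = [s]"
    unfolding peq_def using no_step by (auto elim: converse_rtranclpE)
qed

lemma dv_refl [simp]: "u \<unlhd> u"
  unfolding dv_def by (rule bexI[of _ "[]"]) auto

lemma dv_trans [trans]: "u \<unlhd> v \<Longrightarrow> v \<unlhd> w \<Longrightarrow> u \<unlhd> w"
proof -
  assume "u \<unlhd> v" "v \<unlhd> w"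
  then obtain y z where "y \<in> lists S" "z \<in> lists S" "u @ y \<sim> v" "v @ z \<sim> w" by (auto simp: dv_def)
  then have "u @ (y @ z) \<sim> w" "y @ z \<in> lists S" using peq_appendR[of "u @ y" v z] by (auto intro: peq_trans)
  then show ?thesis unfolding dv_def by blast
qed

lemma dv_peq: "u \<unlhd> v \<Longrightarrow> v \<sim> w \<Longrightarrow> u \<unlhd> w"
  unfolding dv_def by (blast intro: peq_trans)

lemma peq_dv: "u \<sim> v \<Longrightarrow> v \<unlhd> w \<Longrightarrow> u \<unlhd> w"
  unfolding dv_def by (blast intro: peq_trans peq_appendR)

lemma peq_imp_dv: "u \<sim> v \<Longrightarrow> u \<unlhd> v"
  using dv_peq[of u u v] by simp

lemma dv_Nil [simp]: "w \<in> lists S \<Longrightarrow> [] \<unlhd> w"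
  unfolding dv_def by (rule bexI[of _ w]) auto

lemma dv_append [simp]: "w \<in> lists S \<Longrightarrow> u \<unlhd> u @ w"
  unfolding dv_def by (rule bexI[of _ w]) auto

lemma dv_append_mono: "u \<unlhd> w \<Longrightarrow> x @ u \<unlhd> x @ w"
  unfolding dv_def using peq_appendL by fastforce

lemma dv_Cons_mono: "u \<unlhd> w \<Longrightarrow> s # u \<unlhd> s # w"
  using dv_append_mono[of u w "[s]"] by simp

lemma dv_length: "u \<unlhd> w \<Longrightarrow> length u \<le> length w"
  unfolding dv_def using peq_length by fastforce

lemma dv_length_eq: "u \<unlhd> w \<Longrightarrow> length u = length w \<Longrightarrow> u \<sim> w"
  unfolding dv_def using peq_length by fastforce

lemma dv_lists: "u \<unlhd> w \<Longrightarrow> w \<in> lists S \<Longrightarrow> u \<in> lists S"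
  unfolding dv_def using peq_lists by fastforce

lemma dv_red: "u \<unlhd> w \<Longrightarrow> red w \<Longrightarrow> red u"
  unfolding dv_def using peq_red red_appendD by blast

lemma dv_ConsE:
  assumes "s # u \<unlhd> w" "w \<in> lists S"
  obtains w' where "w' \<in> lists S" "s # w' \<sim> w" "u \<unlhd> w'"
proof -
  from assms obtain z where "z \<in> lists S" "s # (u @ z) \<sim> w" by (auto simp: dv_def)
  moreover from this assms(2) have "u @ z \<in> lists S" using peq_lists[of "s # (u @ z)" w] by auto
  ultimately show ?thesis using that[of "u @ z"] by simp
qed

text \<open>Both alternating prefixes are lengthened together. Since \<open>b\<close> is a left
  descent of \<open>w\<close>, exchange deletes a letter from alt a b n @ z. A deletion inside the
  alternating part would contradict \<open>red_alt\<close>, so it occurs in \<open>z\<close>, and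
  putting \<open>b\<close> in front gives the prefix alt b a (Suc n).\<close>

lemma dihedral_dv_ceq:
  assumes w: "red w" and st: "s \<in> S" "t \<in> S" "s \<noteq> t"
    and red: "\<not> red (s # w)" "\<not> red (t # w)" and n: "n \<le> m s t"
  shows "(\<exists>z. alt s t n @ z \<approx> w \<and> n + length z = length w)
       \<and> (\<exists>z. alt t s n @ z \<approx> w \<and> n + length z = length w)"
  using n
proof (induction n)
  case 0
  show ?case by (auto intro: cox_eq.refl)
next
  case (Suc n)
  have step: "\<exists>z. alt b a (Suc n) @ z \<approx> w \<and> Suc n + length z = length w"
    if z: "alt a b n @ z \<approx> w" "n + length z = length w"
      and ab: "{a, b} = {s, t}" for a b z
  proof -
    have b: "b \<in> S" "\<not> red (b # w)" "red (alt b a (Suc n))"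
      using ab st red red_alt[of a b "Suc n"] red_alt[of b a "Suc n"] Suc.prems m_sym[of s t]
      by (auto simp: doubleton_eq_iff)
    have "red (alt a b n @ z)" using red_ceq[OF w] z by (simp add: cox_eq.sym)
    moreover have "\<not> red (b # alt a b n @ z)"
      using b(2) red_ceq[of "b # alt a b n @ z" "b # w"] ceq_Cons[OF z(1)] z(2) by auto
    ultimately obtain x r y where xry: "alt a b n @ z = x @ r # y" "b # alt a b n @ z \<approx> x @ y"
      using exchange b(1) by blast
    have lists: "z \<in> lists S" using \<open>red (alt a b n @ z)\<close> by (auto simp: atom_def)
    show ?thesis
    proof (cases "length x < n")
      case True
      have "\<exists>v. y = v @ z \<and> alt a b n = x @ r # v"
      proof -
        obtain us where "alt a b n @ us = x \<and> z = us @ r # y \<or> alt a b n = x @ us \<and> us @ z = r # y"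
          using xry(1) by (auto simp: append_eq_append_conv2)
        then show ?thesis using True
          by (cases us) (auto dest: arg_cong[of _ _ length])
      qed
      then obtain v where v: "y = v @ z" "alt a b n = x @ r # v" by blast
      then have "(b # alt a b n) @ z \<approx> (x @ v) @ z" using xry(2) by simp
      then have "b # alt a b n \<approx> x @ v" using lists by (rule ceq_cancelR)
      then have "length (b # alt a b n) \<le> length (x @ v)"
        using b(3) red_le[of "b # alt a b n" "x @ v"] by (simp add: alt_Suc)
      then show ?thesis using arg_cong[OF v(2), of length] by simp
    next
      case False
      have "\<exists>u. x = alt a b n @ u \<and> z = u @ r # y"
      proof -
        obtain us where "alt a b n @ us = x \<and> z = us @ r # y \<or> alt a b n = x @ us \<and> us @ z = r # y"
          using xry(1) by (auto simp: append_eq_append_conv2)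
        then show ?thesis using False
          by (cases us) (auto dest: arg_cong[of _ _ length])
      qed
      then obtain u where u: "x = alt a b n @ u" "z = u @ r # y" by blast
      have "[b] @ (b # w) \<approx> w" using cox_eq.sq[of b S m "[]" w] b by simp
      moreover have "b # w \<approx> x @ y"
        using xry(2) ceq_Cons[OF z(1), of b] by (auto intro: cox_eq.trans cox_eq.sym)
      ultimately have "[b] @ (x @ y) \<approx> w" using ceq_appendL[of "b # w" "x @ y" "[b]"]
        by (blast intro: cox_eq.trans cox_eq.sym)
      then have "alt b a (Suc n) @ (u @ y) \<approx> w" by (simp add: alt_Suc u)
      moreover have "Suc n + length (u @ y) = length w" using z(2) u(2) by simp
      ultimately show ?thesis by blast
    qed
  qed
  from Suc obtain z z' where "alt s t n @ z \<approx> w" "n + length z = length w"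
    "alt t s n @ z' \<approx> w" "n + length z' = length w" by force
  with step[of s t z] step[of t s z'] show ?case by (simp add: insert_commute)
qed

lemma not_red_if_ceq_Cons:
  assumes "red w" "s # u \<approx> w" "length w = Suc (length u)" "s \<in> S"
  shows "\<not> red (s # w)"
proof
  assume "red (s # w)"
  moreover have "s # w \<approx> u"
    using ceq_Cons[OF cox_eq.sym[OF assms(2)], of s] cox_eq.sq[of s S m "[]" u] assms(4)
    by (auto intro: cox_eq.trans)
  ultimately show False using red_le assms(3) by fastforce
qed

text \<open>If the first letters \<open>s\<close> and \<open>t\<close> differ, both are descents, so
  the element also has reduced words beginning with either side of the braid relation of
  \<open>s\<close> and \<open>t\<close>. The induction hypothesis, applied after removal of a common
  first letter, joins \<open>u\<close> to one of these words and \<open>v\<close> to the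
  other.\<close>

theorem matsumoto: "red u \<Longrightarrow> red v \<Longrightarrow> u \<approx> v \<Longrightarrow> u \<sim> v"
proof (induction "length u" arbitrary: u v)
  case 0
  then have "length v = 0" using red_le[of v u] cox_eq.sym by fastforce
  then show ?case using 0 by simp
next
  case (Suc n)
  have len: "length v = Suc n" using Suc red_le[of v u] red_le[of u v] cox_eq.sym by fastforce
  obtain s u' t v' where u: "u = s # u'" and v: "v = t # v'" using Suc(2) len by (cases u; cases v) auto
  have st: "s \<in> S" "t \<in> S" and red: "red u'" "red v'" using Suc.prems u v red_ConsD by auto
  have lengths: "n = length u'" "n = length v'" using Suc(2) len u v by auto
  show ?case
  proof (cases "s = t")
    case True
    then have "u' \<approx> v'" using Suc.prems(3) ceq_cancelL[of "[s]" u' v'] st by (simp add: u v)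
    then have "u' \<sim> v'" using Suc.hyps(1)[OF lengths(1)] red by simp
    then show ?thesis using True peq_Cons by (simp add: u v)
  next
    case False
    have "\<not> red (s # u)" using not_red_if_ceq_Cons[of u s u'] Suc.prems(1) cox_eq.refl st u by auto
    moreover have "\<not> red (t # u)"
      using not_red_if_ceq_Cons[of u t v'] Suc.prems cox_eq.sym st v lengths u by auto
    ultimately obtain z where z: "alt s t (m s t) @ z \<approx> u" "m s t + length z = length u"
      using dihedral_dv_ceq[OF Suc.prems(1) st False] by blast
    obtain k where k: "m s t = Suc k" using m_ge2[OF st False] by (cases "m s t") auto
    have 1: "s # (alt t s k @ z) \<approx> u" using z by (simp add: k alt_Suc)
    have sw: "alt s t (m s t) @ z \<sim> alt t s (m s t) @ z" using peq_alt[OF st False] by (rule peq_appendR)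
    then have 2: "t # (alt s t k @ z) \<approx> u"
      using peq_ceq[OF sw] z(1) by (auto simp: k alt_Suc intro: cox_eq.trans cox_eq.sym)
    have r: "red (s # (alt t s k @ z))" "red (t # (alt s t k @ z))"
      using red_ceq[OF Suc.prems(1) cox_eq.sym[OF 1]] red_ceq[OF Suc.prems(1) cox_eq.sym[OF 2]] z(2)
      by (auto simp: k)
    have "u' \<approx> alt t s k @ z"
      using ceq_cancelL[of "[s]" u' "alt t s k @ z"] cox_eq.sym[OF 1] st by (simp add: u)
    then have "u' \<sim> alt t s k @ z" using Suc.hyps(1)[OF lengths(1) red(1)] r red_ConsD by blast
    then have "u \<sim> alt s t (m s t) @ z" using peq_Cons[of _ _ s] by (simp add: u k alt_Suc)
    also note sw
    also have "alt t s (m s t) @ z \<sim> v"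
    proof -
      have "t # (alt s t k @ z) \<approx> v" using 2 Suc.prems(3) by (rule cox_eq.trans)
      from cox_eq.sym[OF this] have "v' \<approx> alt s t k @ z"
        using ceq_cancelL[of "[t]" v' "alt s t k @ z"] st by (simp add: v)
      then have "v' \<sim> alt s t k @ z" using Suc.hyps(1)[OF lengths(2) red(2)] r red_ConsD by blast
      then show ?thesis using peq_Cons[of _ _ t] peq_sym by (simp add: v k alt_Suc)
    qed
    finally show ?thesis .
  qed
qed

text \<open>For reduced words this is the last clause of \<open>garside_class\<close>; Matsumoto's
  theorem lifts it from the Coxeter group to the monoid.\<close>

lemma red_dihedral:
  assumes w: "red w" and st: "s \<noteq> t" and dv: "[s] \<unlhd> w" "[t] \<unlhd> w"
  shows "alt s t (m s t) \<unlhd> w"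
proof -
  have *: "r \<in> S \<and> \<not> red (r # w)" if r: "[r] \<unlhd> w" for r
  proof -
    obtain u where u: "r # u \<sim> w" using r by (auto simp: dv_def)
    then have "r \<in> S" using peq_lists[OF u] red_lists[OF w] by simp
    then show ?thesis using not_red_if_ceq_Cons[OF w peq_ceq[OF u]] peq_length[OF u] by auto
  qed
  obtain z where z: "alt s t (m s t) @ z \<approx> w" "m s t + length z = length w"
    using dihedral_dv_ceq[OF w, of s t] * dv st by blast
  then have "red (alt s t (m s t) @ z)" using red_ceq[OF w] by (simp add: cox_eq.sym)
  moreover from this have "alt s t (m s t) @ z \<sim> w" using matsumoto w z by blast
  ultimately show ?thesis unfolding dv_def using red_lists by fastforce
qed

lemma red_cancel:
  assumes "red (s # u)" "s # u \<sim> s # v"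
  shows "u \<sim> v"
proof -
  have "red (s # v)" using assms peq_red by blast
  moreover have "u \<approx> v" using ceq_cancelL[of "[s]" u v] peq_ceq[OF assms(2)] red_ConsD[OF assms(1)] by simp
  ultimately show ?thesis using matsumoto assms red_ConsD by blast
qed


section \<open>Common multiples\<close>

text \<open>Needed relative to a class \<open>X\<close>: the cube condition uses joins in the class of reduced words
  together with the words of smaller length, where the last two clauses are known from Matsumoto's
  theorem and from the induction hypothesis, respectively.\<close>

definition garside_class :: "('a list \<Rightarrow> bool) \<Rightarrow> bool" where
  "garside_class X \<longleftrightarrow>
     (\<forall>g. X g \<longrightarrow> g \<in> lists S) \<and>
     (\<forall>g h. X g \<longrightarrow> g \<sim> h \<longrightarrow> X h) \<and>
     (\<forall>s g. X (s # g) \<longrightarrow> X g) \<and>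
     (\<forall>s x y. X (s # x) \<longrightarrow> s # x \<sim> s # y \<longrightarrow> x \<sim> y) \<and>
     (\<forall>g s t. X g \<longrightarrow> s \<noteq> t \<longrightarrow> [s] \<unlhd> g \<longrightarrow> [t] \<unlhd> g \<longrightarrow> alt s t (m s t) \<unlhd> g)"

lemma alt_pred: "s \<in> S \<Longrightarrow> t \<in> S \<Longrightarrow> s \<noteq> t \<Longrightarrow> alt s t (m s t) = s # alt t s (m s t - 1)"
  using m_ge2[of s t] alt_Suc[of s t "m s t - 1"] by simp

lemma alt_pred':
  assumes "s \<in> S" "t \<in> S" "s \<noteq> t"
  shows "alt t s (m s t) = t # alt s t (m s t - 1)"
  using alt_pred[of t s] assms m_sym[of s t] by auto

lemma alt_pred_peq:
  "s \<in> S \<Longrightarrow> t \<in> S \<Longrightarrow> s \<noteq> t \<Longrightarrow> s # alt t s (m s t - 1) \<sim> t # alt s t (m s t - 1)"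
  using peq_alt[of s t] alt_pred[of s t] alt_pred'[of s t] by simp

context
  fixes X :: "'a list \<Rightarrow> bool"
  assumes X: "garside_class X"
begin

lemma class_lists: "X g \<Longrightarrow> g \<in> lists S"
  using X unfolding garside_class_def by blast

lemma class_peq: "X g \<Longrightarrow> g \<sim> h \<Longrightarrow> X h"
  using X unfolding garside_class_def by blast

lemma class_tail: "X (s # g) \<Longrightarrow> X g"
  using X unfolding garside_class_def by blast

lemma class_cancel_Cons: "X (s # x) \<Longrightarrow> s # x \<sim> s # y \<Longrightarrow> x \<sim> y"
  using X unfolding garside_class_def by blast

lemma class_dihedral: "X g \<Longrightarrow> s \<noteq> t \<Longrightarrow> [s] \<unlhd> g \<Longrightarrow> [t] \<unlhd> g \<Longrightarrow> alt s t (m s t) \<unlhd> g"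
  using X unfolding garside_class_def by blast

lemma class_cancel: "X (u @ x) \<Longrightarrow> u @ x \<sim> u @ y \<Longrightarrow> x \<sim> y"
proof (induction u)
  case (Cons s u)
  then show ?case using class_tail[of s "u @ x"] class_cancel_Cons[of s "u @ x" "u @ y"] by simp
qed simp

lemma class_dv_Cons:
  assumes "X w" "s # w' \<sim> w" "s # u \<unlhd> w"
  shows "u \<unlhd> w'"
proof -
  obtain w'' where w'': "s # w'' \<sim> w" "u \<unlhd> w''"
    using dv_ConsE[OF assms(3) class_lists[OF assms(1)]] by blast
  then have "s # w'' \<sim> s # w'" using assms(2) peq_sym peq_trans by blast
  moreover have "X (s # w'')" using assms(1) w''(1) class_peq peq_sym by blast
  ultimately have "w'' \<sim> w'" using class_cancel_Cons by blast
  with w''(2) show ?thesis by (rule dv_peq)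
qed

lemma class_dvE:
  assumes "X w" "s # u \<unlhd> w"
  obtains w' where "X w'" "s # w' \<sim> w" "u \<unlhd> w'" "s \<in> S"
proof -
  obtain w' where w': "s # w' \<sim> w" "u \<unlhd> w'"
    using dv_ConsE[OF assms(2) class_lists[OF assms(1)]] by blast
  then have "X (s # w')" using assms(1) class_peq peq_sym by blast
  then show ?thesis using that[OF class_tail w'] class_lists[of "s # w'"] by auto
qed

text \<open>The induction runs over the length of a known common multiple. If the first letters
  differ, every common multiple in \<open>X\<close> is divisible by the dihedral word s # p \<sim> t
  # q. So \<open>u'\<close> is first joined with \<open>p\<close> below \<open>s\<close>; the result
  s # j is rewritten as t # k, and \<open>k\<close> is joined with \<open>v'\<close> below
  \<open>t\<close>.\<close>

theorem class_join:
  "X w \<Longrightarrow> u \<unlhd> w \<Longrightarrow> v \<unlhd> w \<Longrightarrow>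
    \<exists>j. u \<unlhd> j \<and> v \<unlhd> j \<and> (\<forall>g. X g \<longrightarrow> u \<unlhd> g \<longrightarrow> v \<unlhd> g \<longrightarrow> j \<unlhd> g)"
proof (induction "length w" arbitrary: u v w rule: less_induct)
  case less
  have lists: "u \<in> lists S" "v \<in> lists S"
    using less.prems class_lists dv_lists by blast+
  show ?case
  proof (cases u)
    case Nil
    then show ?thesis using lists by (intro exI[of _ v]) auto
  next
    case (Cons s u')
    note u = this
    show ?thesis
    proof (cases v)
      case Nil
      then show ?thesis using lists by (intro exI[of _ u]) auto
    next
      case (Cons t v')
      note v = this
      have st: "s \<in> S" "t \<in> S" using lists u v by auto
      have [simp]: "[s] \<unlhd> u" "[t] \<unlhd> v" using dv_append[of u' "[s]"] dv_append[of v' "[t]"] lists u v by auto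
      obtain w' where w': "X w'" "s # w' \<sim> w" "u' \<unlhd> w'"
        using class_dvE less.prems(1,2) u by metis
      have shorter: "length w' < length w" using peq_length[OF w'(2)] by simp
      show ?thesis
      proof (cases "s = t")
        case True
        then have "v' \<unlhd> w'" using class_dv_Cons[OF less.prems(1) w'(2)] less.prems(3) v by simp
        then obtain j where j: "u' \<unlhd> j" "v' \<unlhd> j" "\<And>g. X g \<Longrightarrow> u' \<unlhd> g \<Longrightarrow> v' \<unlhd> g \<Longrightarrow> j \<unlhd> g"
          using less.hyps[OF shorter w'(1,3)] by blast
        have "s # j \<unlhd> g" if g: "X g" "u \<unlhd> g" "v \<unlhd> g" for g
        proof -
          obtain g' where g': "X g'" "s # g' \<sim> g" "u' \<unlhd> g'"
            using class_dvE g(1,2) u by metis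
          then have "v' \<unlhd> g'" using class_dv_Cons[OF g(1)] g(3) v True by blast
          then have "j \<unlhd> g'" using j g' by blast
          then show ?thesis using dv_Cons_mono g'(2) dv_peq by blast
        qed
        then show ?thesis using j(1,2) dv_Cons_mono u v True by blast
      next
        case False
        define p q where "p = alt t s (m s t - 1)" and "q = alt s t (m s t - 1)"
        have sp: "alt s t (m s t) = s # p" and pq: "s # p \<sim> t # q"
          using alt_pred[OF st False] alt_pred_peq[OF st False] by (auto simp: p_def q_def)
        have lcm: "s # p \<unlhd> g" if "X g" "u \<unlhd> g" "v \<unlhd> g" for g
        proof -
          have "[s] \<unlhd> g" "[t] \<unlhd> g"
            using that dv_trans \<open>[s] \<unlhd> u\<close> \<open>[t] \<unlhd> v\<close> by blast+
          then show ?thesis using class_dihedral[OF that(1) False] by (simp add: sp)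
        qed
        have "p \<unlhd> w'" using class_dv_Cons[OF less.prems(1) w'(2)] lcm less.prems by blast
        then obtain j where j: "u' \<unlhd> j" "p \<unlhd> j" "\<And>g. X g \<Longrightarrow> u' \<unlhd> g \<Longrightarrow> p \<unlhd> g \<Longrightarrow> j \<unlhd> g"
          using less.hyps[OF shorter w'(1,3)] by blast
        have sj: "s # j \<unlhd> g" if g: "X g" "u \<unlhd> g" "v \<unlhd> g" for g
        proof -
          obtain g' where g': "X g'" "s # g' \<sim> g" "u' \<unlhd> g'"
            using class_dvE g(1,2) u by metis
          then have "p \<unlhd> g'" using class_dv_Cons[OF g(1)] lcm[OF g] by blast
          then have "j \<unlhd> g'" using j g' by blast
          then show ?thesis using dv_Cons_mono g'(2) dv_peq by blast
        qed
        obtain y where y: "p @ y \<sim> j" using j(2) by (auto simp: dv_def)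
        define k where "k = q @ y"
        have "t # k \<sim> s # p @ y" using peq_appendR[OF peq_sym[OF pq], of y] by (simp add: k_def)
        also have "s # p @ y \<sim> s # j" using y by (rule peq_Cons)
        finally have tk: "t # k \<sim> s # j" .
        have tk_dv: "t # k \<unlhd> g" if "X g" "u \<unlhd> g" "v \<unlhd> g" for g
          using sj[OF that] tk peq_dv by blast
        obtain w'' where w'': "X w''" "t # w'' \<sim> w" "k \<unlhd> w''"
          using class_dvE tk_dv less.prems by metis
        have shorter': "length w'' < length w" using peq_length[OF w''(2)] by simp
        have "v' \<unlhd> w''" using class_dv_Cons[OF less.prems(1) w''(2)] less.prems(3) v by blast
        then obtain i where i: "k \<unlhd> i" "v' \<unlhd> i" "\<And>g. X g \<Longrightarrow> k \<unlhd> g \<Longrightarrow> v' \<unlhd> g \<Longrightarrow> i \<unlhd> g"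
          using less.hyps[OF shorter' w''(1,3)] by blast
        have "u \<unlhd> s # j" using j(1) dv_Cons_mono u by blast
        also have "s # j \<unlhd> t # i" using tk peq_sym peq_dv dv_Cons_mono[OF i(1)] by blast
        finally have "u \<unlhd> t # i" .
        moreover have "v \<unlhd> t # i" using i(2) dv_Cons_mono v by blast
        moreover have "t # i \<unlhd> g" if g: "X g" "u \<unlhd> g" "v \<unlhd> g" for g
        proof -
          obtain g' where g': "X g'" "t # g' \<sim> g" "v' \<unlhd> g'"
            using class_dvE g(1,3) v by metis
          then have "k \<unlhd> g'" using class_dv_Cons[OF g(1)] tk_dv[OF g] by blast
          then have "i \<unlhd> g'" using i g' by blast
          then show ?thesis using dv_Cons_mono g'(2) dv_peq by blast
        qed
        ultimately show ?thesis by blast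
      qed
    qed
  qed
qed

end

lemma descent_dv:
  assumes "red w" "s \<in> S" "\<not> red (s # w)"
  shows "[s] \<unlhd> w"
proof -
  obtain x r y where *: "w = x @ r # y" "s # w \<approx> x @ y" using exchange[OF assms] by blast
  have "s # x @ y \<approx> s # s # w" using ceq_Cons[OF *(2), of s] by (rule cox_eq.sym)
  also have "s # s # w \<approx> w" using cox_eq.sq[of s S m "[]" w] assms(2) by simp
  finally have sxy: "s # x @ y \<approx> w" .
  moreover have "red (s # x @ y)" using red_ceq[OF assms(1) cox_eq.sym[OF sxy]] * by simp
  ultimately have "s # x @ y \<sim> w" using matsumoto assms(1) by blast
  moreover have "x @ y \<in> lists S" using red_lists[OF assms(1)] * by auto
  ultimately show ?thesis unfolding dv_def by force
qed

end

section \<open>The longest element as a common multiple of all reduced words\<close>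

locale finite_type_coxeter = coxeter +
  fixes d :: "'a list"
  assumes is_Delta: "is_Delta S m d"
begin

lemma red_Delta: "red d"
  using is_Delta by (simp add: is_Delta_def)

lemma Delta_lists [simp]: "d \<in> lists S"
  using red_Delta by (rule red_lists)

lemma Delta_max: "w \<in> lists S \<Longrightarrow> cl w \<le> length d"
  using is_Delta by (simp add: is_Delta_def atom_def)

text \<open>Multiplication by a reflection changes the parity of the length, and from the maximal
  length it can only go down.\<close>

lemma inverts_Delta:
  assumes "u \<in> lists S" "s \<in> S"
  shows "inverts d (u @ [s] @ rev u)"
proof -
  let ?t = "u @ [s] @ rev u"
  have lists: "?t @ d \<in> lists S" using assms Delta_lists by (auto simp: in_lists_conv_set)
  have "cl (?t @ d) \<noteq> length d" using cl_even[OF lists] by auto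
  then have "cl (?t @ d) < length d" using Delta_max[OF lists] by simp
  then show ?thesis using inverts_iff_shorter[OF red_Delta] assms by blast
qed

text \<open>The word is built letter by letter. If u @ z \<sim> d and u @ [s] is reduced, then the
  reflection u s u^-1 is inverted by \<open>d\<close> but not by \<open>u\<close>; hence
  \<open>z\<close> inverts \<open>s\<close>, which makes \<open>s\<close> a left divisor of
  \<open>z\<close>.\<close>

theorem red_dv_Delta: "red u \<Longrightarrow> u \<unlhd> d"
proof (induction u rule: rev_induct)
  case (snoc s u)
  then have us: "red u" "u \<in> lists S" "s \<in> S" using red_appendD[of u "[s]"] red_lists[of "u @ [s]"] by auto
  then obtain z where z: "z \<in> lists S" "u @ z \<sim> d" using snoc by (auto simp: dv_def)
  let ?t = "u @ [s] @ rev u"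
  have "inverts (u @ z) ?t" using inverts_Delta us inverts_ceq[OF peq_ceq[OF z(2)]] by blast
  moreover have "\<not> inverts u ?t"
  proof -
    have "u @ [s] @ (rev u @ u) \<approx> u @ [s] @ []" using us by (intro ceq_append cox_eq.refl ceq_inv')
    then have "cl (?t @ u) = length (u @ [s])"
      using cl_cong[of "?t @ u" "u @ [s]"] snoc.prems by (simp add: atom_def)
    then show ?thesis using inverts_iff_shorter[OF us(1) HOL.refl us(2,3)] by simp
  qed
  moreover have "[s] \<approx> rev u @ ?t @ u" using ceq_conjugate_iff[of u "[s]" ?t] us cox_eq.refl by simp
  ultimately have "inverts z [s]" using inverts_append inverts_cong by blast
  moreover have red: "red z" using peq_red[OF z(2)] red_Delta red_appendD by blast
  ultimately have "cl (s # z) < length z" using inverts_iff_shorter[of z "[s]" "[]" s] us by simp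
  then have "[s] \<unlhd> z" using descent_dv[OF red us(3)] by (auto simp: atom_def)
  then have "u @ [s] \<unlhd> u @ z" by (rule dv_append_mono)
  then show ?case using z(2) by (rule dv_peq)
qed simp

section \<open>Cancellation and dihedral multiples in the monoid\<close>

text \<open>For equivalent words, the first clause is left cancellation of a letter, and the second
  is factorisation through the dihedral common multiple of two different first letters.\<close>

definition garside_rel :: "'a list \<Rightarrow> 'a list \<Rightarrow> bool" where
  "garside_rel g h \<longleftrightarrow> (\<forall>s x t y. g = s # x \<longrightarrow> h = t # y \<longrightarrow>
     (s = t \<longrightarrow> x \<sim> y) \<and>
     (s \<noteq> t \<longrightarrow> (\<exists>z. x \<sim> alt t s (m s t - 1) @ z \<and> y \<sim> alt s t (m s t - 1) @ z)))"

lemma garside_rel_step: "bstep g h \<Longrightarrow> garside_rel g h"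
proof (induction rule: bstep.induct)
  case (1 a b u w)
  note ab = 1
  show ?case
  proof (cases u)
    case Nil
    then show ?thesis
      using ab unfolding garside_rel_def alt_pred[OF ab] alt_pred'[OF ab] by (auto intro!: exI[of _ w])
  next
    case (Cons r v)
    have "v @ alt a b (m a b) @ w \<sim> v @ alt b a (m a b) @ w"
      using peq_alt[OF ab] by (rule peq_context)
    then show ?thesis unfolding garside_rel_def Cons by auto
  qed
qed

text \<open>This is the cube condition for first letters \<open>s\<close>, \<open>r\<close>,
  \<open>t\<close>. If the three differ, the common multiple is formed among reduced words, where
  Matsumoto's theorem gives divisibility and cancellation, and the remaining factor is appended
  afterwards.\<close>

lemma garside_rel_trans:
  assumes X: "garside_class X" "\<And>w. red w \<Longrightarrow> X w" "\<And>s x. g = s # x \<Longrightarrow> X x"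
    "\<And>r e. w = r # e \<Longrightarrow> X e"
    and g: "g \<in> lists S" "g \<sim> w" "w \<sim> h"
    and gw: "garside_rel g w" and wh: "garside_rel w h"
  shows "garside_rel g h"
  unfolding garside_rel_def
proof (intro allI impI)
  fix s x t y assume gh: "g = s # x" "h = t # y"
  obtain r e where w: "w = r # e" using peq_length[OF g(2)] gh(1) by (cases w) auto
  have X': "X x" "X e" using X gh(1) w by blast+
  have srt: "s \<in> S" "r \<in> S" "t \<in> S" using g peq_lists[of g w] peq_lists[of w h] gh w by auto
  note gw = gw[unfolded garside_rel_def, rule_format, OF gh(1) w]
  note wh = wh[unfolded garside_rel_def, rule_format, OF w gh(2)]
  show "(s = t \<longrightarrow> x \<sim> y) \<and>
     (s \<noteq> t \<longrightarrow> (\<exists>z. x \<sim> alt t s (m s t - 1) @ z \<and> y \<sim> alt s t (m s t - 1) @ z))"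
  proof (cases "s = r \<or> r = t")
    case True
    then show ?thesis using gw wh by (blast intro: peq_trans peq_sym)
  next
    case False
    then obtain z1 z2 where z1: "x \<sim> alt r s (m s r - 1) @ z1" "e \<sim> alt s r (m s r - 1) @ z1"
      and z2: "e \<sim> alt t r (m r t - 1) @ z2" "y \<sim> alt r t (m r t - 1) @ z2"
      using gw wh by blast
    show ?thesis
    proof (cases "s = t")
      case True
      then have "alt s r (m s r - 1) @ z1 \<sim> alt s r (m s r - 1) @ z2"
        using z1(2) z2(1) m_sym[OF srt(1,2)] by (auto intro: peq_trans peq_sym)
      moreover have "X (alt s r (m s r - 1) @ z1)" using class_peq[OF X(1) X'(2) z1(2)] .
      ultimately have "z1 \<sim> z2" using class_cancel[OF X(1)] by blast
      then show ?thesis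
        using True z1(1) z2(2) m_sym[OF srt(1,2)] peq_appendL[of z1 z2] by (auto intro: peq_trans peq_sym)
    next
      case st: False
      \<comment> \<open>The words s # p1 \<sim> r # u1 and r # u2 \<sim> t # p2 are the dihedral
        common multiples of \<open>r\<close> with \<open>s\<close> and with
        \<open>t\<close>.\<close>
      define u1 u2 p1 p2 where "u1 = alt s r (m s r - 1)" and "u2 = alt t r (m r t - 1)"
        and "p1 = alt r s (m s r - 1)" and "p2 = alt r t (m r t - 1)"
      have e1: "s # p1 \<sim> r # u1" and e2: "r # u2 \<sim> t # p2"
        using alt_pred_peq[of s r] alt_pred_peq[of r t] srt False
        by (auto simp: u1_def u2_def p1_def p2_def)
      have red: "red (r # u1)" "red (r # u2)"
        using red_alt[of r s "m r s"] red_alt[of r t "m r t"] alt_pred[of r s] alt_pred[of r t]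
          m_sym[of s r] srt False by (auto simp: u1_def u2_def)
      \<comment> \<open>\<open>class_join\<close> needs some common multiple of \<open>u1\<close>
        and \<open>u2\<close>. It is what remains of \<Delta> after removal of \<open>r\<close>; by
        leastness r # j then divides \<Delta> and is reduced.\<close>
      obtain d' where d': "X d'" "r # d' \<sim> d" "u1 \<unlhd> d'"
        using class_dvE[OF X(1) X(2)[OF red_Delta] red_dv_Delta[OF red(1)]] by blast
      have "u2 \<unlhd> d'" using class_dv_Cons[OF X(1) X(2)[OF red_Delta] d'(2) red_dv_Delta[OF red(2)]] .
      then obtain j where j: "u1 \<unlhd> j" "u2 \<unlhd> j" "\<And>g. X g \<Longrightarrow> u1 \<unlhd> g \<Longrightarrow> u2 \<unlhd> g \<Longrightarrow> j \<unlhd> g"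
        using class_join[OF X(1) d'(1,3)] by blast
      have rj: "red (r # j)"
        using dv_Cons_mono[OF j(3)[OF d'(1,3) \<open>u2 \<unlhd> d'\<close>], of r] d'(2) red_Delta dv_red dv_peq by blast
      have lists: "z1 \<in> lists S" "z2 \<in> lists S"
        using class_lists[OF X(1) X'(2)] peq_lists[OF z1(2)] peq_lists[OF z2(1)] by auto
      have "u1 \<unlhd> e" "u2 \<unlhd> e" using z1(2) z2(1) lists unfolding dv_def u1_def u2_def by (blast intro: peq_sym)+
      then have "j \<unlhd> e" using j(3) X'(2) by blast
      \<comment> \<open>The tail \<open>e\<close> is a common multiple of \<open>u1\<close> and
        \<open>u2\<close> as well, so it splits as \<open>j\<close> followed by a rest
        \<open>z3\<close>, which is the same for both sides.\<close>
      then obtain z3 where z3: "j @ z3 \<sim> e" by (auto simp: dv_def)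
      obtain a1 a2 where a: "u1 @ a1 \<sim> j" "u2 @ a2 \<sim> j" "a1 \<in> lists S" "a2 \<in> lists S"
        using j(1,2) by (auto simp: dv_def)
      have *: "z \<sim> a @ z3" if "u @ a \<sim> j" "e \<sim> u @ z" for u a z
      proof -
        have "u @ z \<sim> e" using that(2) by (rule peq_sym)
        also have "e \<sim> j @ z3" using z3 by (rule peq_sym)
        also have "j @ z3 \<sim> u @ a @ z3" using peq_appendR[OF peq_sym[OF that(1)], of z3] by simp
        finally show ?thesis
          using class_cancel[OF X(1) class_peq[OF X(1) X'(2) that(2)]] by blast
      qed
      have x: "x \<sim> p1 @ a1 @ z3"
        using z1(1) peq_appendL[OF *[OF a(1)], of z1 p1] z1(2) unfolding u1_def p1_def by (blast intro: peq_trans)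
      have y: "y \<sim> p2 @ a2 @ z3"
        using z2(2) peq_appendL[OF *[OF a(2)], of z2 p2] z2(1) unfolding u2_def p2_def by (blast intro: peq_trans)
      have 1: "s # (p1 @ a1) \<sim> r # j"
        using peq_appendR[OF e1, of a1] peq_Cons[OF a(1), of r] by (auto intro: peq_trans)
      have 2: "t # (p2 @ a2) \<sim> r # j"
        using peq_appendR[OF peq_sym[OF e2], of a2] peq_Cons[OF a(2), of r] by (auto intro: peq_trans)
      have "[s] \<unlhd> r # j" "[t] \<unlhd> r # j"
        using dv_peq[OF dv_append[of "p1 @ a1" "[s]"], of "r # j"] dv_peq[OF dv_append[of "p2 @ a2" "[t]"], of "r # j"]
          1 2 peq_lists[OF 1] peq_lists[OF 2] red_lists[OF rj] by auto
      then obtain b where b: "alt s t (m s t) @ b \<sim> r # j"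
        using red_dihedral[OF rj st] by (auto simp: dv_def)
      have b': "alt t s (m s t) @ b \<sim> r # j"
        using peq_appendR[OF peq_alt[OF srt(1,3) st], of b] b by (blast intro: peq_trans peq_sym)
      have "p1 @ a1 \<sim> alt t s (m s t - 1) @ b"
        using red_cancel[of s "p1 @ a1" "alt t s (m s t - 1) @ b"] 1 b peq_red[OF 1] rj
          alt_pred[OF srt(1,3) st] by (auto intro: peq_trans peq_sym)
      then have "(p1 @ a1) @ z3 \<sim> (alt t s (m s t - 1) @ b) @ z3" by (rule peq_appendR)
      then have "x \<sim> alt t s (m s t - 1) @ b @ z3" using x peq_trans by simp
      moreover have "p2 @ a2 \<sim> alt s t (m s t - 1) @ b"
        using red_cancel[of t "p2 @ a2" "alt s t (m s t - 1) @ b"] 2 b' peq_red[OF 2] rj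
          alt_pred'[OF srt(1,3) st] by (auto intro: peq_trans peq_sym)
      then have "(p2 @ a2) @ z3 \<sim> (alt s t (m s t - 1) @ b) @ z3" by (rule peq_appendR)
      then have "y \<sim> alt s t (m s t - 1) @ b @ z3" using y peq_trans by simp
      ultimately show ?thesis using st by blast
    qed
  qed
qed

lemma garside_rel_dihedral:
  assumes st: "s \<noteq> t" and g: "g \<in> lists S" "[s] \<unlhd> g" "[t] \<unlhd> g"
    and rel: "\<And>x y. s # x \<sim> g \<Longrightarrow> t # y \<sim> g \<Longrightarrow> garside_rel (s # x) (t # y)"
  shows "alt s t (m s t) \<unlhd> g"
proof -
  obtain x y where xy: "s # x \<sim> g" "t # y \<sim> g" using g by (auto simp: dv_def)
  then obtain z where z: "x \<sim> alt t s (m s t - 1) @ z"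
    using rel[OF xy] st unfolding garside_rel_def by blast
  have S: "s \<in> S" "t \<in> S" "x \<in> lists S" using xy g peq_lists[OF xy(1)] peq_lists[OF xy(2)] by auto
  have "alt s t (m s t) @ z \<sim> g"
    using peq_Cons[OF peq_sym[OF z], of s] xy(1) alt_pred[OF S(1,2) st] by (auto intro: peq_trans)
  then show ?thesis unfolding dv_def using S(3) peq_lists[OF z] by auto
qed

text \<open>The outer induction is on length and the inner one on the number of braid moves. The
  class \<open>X\<close> consists of the shorter words, covered by the outer hypothesis, and the
  reduced words, covered by Matsumoto's theorem; it contains the tail of every nonempty word in the
  chain.\<close>

theorem garside_rel: "g \<in> lists S \<Longrightarrow> g \<sim> h \<Longrightarrow> garside_rel g h"
proof (induction "length g" arbitrary: g h rule: less_induct)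
  case less
  define X where "X w \<longleftrightarrow> w \<in> lists S \<and> length w < length g \<or> red w" for w
  have X: "garside_class X"
    unfolding garside_class_def
  proof (intro conjI allI impI)
    show "w \<in> lists S" if "X w" for w using that red_lists by (auto simp: X_def)
    show "X v" if "X w" "w \<sim> v" for w v
      using that peq_lists peq_length peq_red by (auto simp: X_def)
    show "X w" if "X (s # w)" for s w using that red_ConsD by (auto simp: X_def)
    show "x \<sim> y" if "X (s # x)" "s # x \<sim> s # y" for s x y
      using that less.hyps[of "s # x" "s # y"] red_cancel unfolding X_def garside_rel_def by blast
    show "alt s t (m s t) \<unlhd> w" if w: "X w" "s \<noteq> t" "[s] \<unlhd> w" "[t] \<unlhd> w" for w s t
    proof (cases "red w")
      case True
      then show ?thesis using red_dihedral w by blast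
    next
      case False
      with w(1) have w': "w \<in> lists S" "length w < length g" by (auto simp: X_def)
      show ?thesis
      proof (rule garside_rel_dihedral[OF w(2) w'(1) w(3,4)])
        fix x y assume "s # x \<sim> w" "t # y \<sim> w"
        then show "garside_rel (s # x) (t # y)"
          using less.hyps[of "s # x" "t # y"] w' peq_length[of "s # x" w] peq_lists[of "s # x" w]
          by (metis peq_sym peq_trans)
      qed
    qed
  qed
  have Xtail: "X x" if "s # x \<sim> g" for s x
    using peq_length[OF that] peq_lists[OF that] less.prems(1) by (auto simp: X_def)
  from less.prems(2) show ?case
    unfolding peq_def
  proof (induction rule: rtranclp_induct)
    case base
    show ?case by (auto simp: garside_rel_def)
  next
    case (step w h)
    have gw: "g \<sim> w" using step(1) by (simp add: peq_def)
    have wh: "w \<sim> h" using step(2) by (auto simp: peq_def)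
    show ?case
    proof (rule garside_rel_trans[OF X _ _ _ less.prems(1) gw wh step(3) garside_rel_step[OF step(2)]])
      show "X v" if "red v" for v using that by (simp add: X_def)
      show "X x" if "g = s # x" for s x using Xtail[of s x] that by simp
      show "X e" if "w = r # e" for r e using Xtail[of r e] that peq_sym[OF gw] by simp
    qed
  qed
qed

lemma garside_class_lists: "garside_class (\<lambda>g. g \<in> lists S)"
  unfolding garside_class_def
proof (intro conjI allI impI)
  show "x \<sim> y" if "s # x \<in> lists S" "s # x \<sim> s # y" for s x y
    using garside_rel[OF that] unfolding garside_rel_def by blast
  show "alt s t (m s t) \<unlhd> g" if g: "g \<in> lists S" "s \<noteq> t" "[s] \<unlhd> g" "[t] \<unlhd> g" for g s t
  proof (rule garside_rel_dihedral[OF g(2,1,3,4)])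
    fix x y assume xy: "s # x \<sim> g" "t # y \<sim> g"
    show "garside_rel (s # x) (t # y)"
      using xy garside_rel[of "s # x" "t # y"] peq_lists[OF xy(1)] g(1) by (blast intro: peq_trans peq_sym)
  qed
qed (use peq_lists in auto)

lemma peq_cancelL: "u @ x \<in> lists S \<Longrightarrow> u @ x \<sim> u @ y \<Longrightarrow> x \<sim> y"
  using class_cancel[OF garside_class_lists] .

text \<open>Braid relations are stable under reversal, which exchanges the two sides of
  cancellation.\<close>

lemma peq_cancelR: "x @ u \<in> lists S \<Longrightarrow> x @ u \<sim> y @ u \<Longrightarrow> x \<sim> y"
proof -
  assume "x @ u \<in> lists S" "x @ u \<sim> y @ u"
  then have "rev u @ rev x \<in> lists S" "rev u @ rev x \<sim> rev u @ rev y"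
    using peq_rev[of "x @ u" "y @ u"] by (auto simp: in_lists_conv_set)
  then have "rev x \<sim> rev y" by (rule peq_cancelL)
  then show "x \<sim> y" using peq_rev[of "rev x" "rev y"] by simp
qed

lemma join_exists:
  assumes "w \<in> lists S" "u \<unlhd> w" "v \<unlhd> w"
  shows "\<exists>j. u \<unlhd> j \<and> v \<unlhd> j \<and> (\<forall>g\<in>lists S. u \<unlhd> g \<longrightarrow> v \<unlhd> g \<longrightarrow> j \<unlhd> g)"
  using class_join[OF garside_class_lists assms] by blast

lemma dv_cancelL: "u @ x \<unlhd> u @ y \<Longrightarrow> u @ y \<in> lists S \<Longrightarrow> x \<unlhd> y"
proof -
  assume "u @ x \<unlhd> u @ y" and lists: "u @ y \<in> lists S"
  then obtain z where z: "z \<in> lists S" "u @ x @ z \<sim> u @ y" by (auto simp: dv_def)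
  then have "x @ z \<sim> y" using peq_cancelL lists peq_lists[OF z(2)] by blast
  with z(1) show ?thesis unfolding dv_def by blast
qed


section \<open>Powers of Delta\<close>

abbreviation wp :: "'b list \<Rightarrow> nat \<Rightarrow> 'b list" where
  "wp w n \<equiv> concat (replicate n w)"

lemma wp_add: "wp w (i + j) = wp w i @ wp w j"
  by (simp add: replicate_add)

lemma wp_lists: "w \<in> lists S \<Longrightarrow> wp w n \<in> lists S"
  by (induction n) auto

lemma wp_length: "length (wp w n) = n * length w"
  by (induction n) auto

lemma wp_wp: "wp (wp w i) j = wp w (i * j)"
  by (induction j) (auto simp: replicate_add)

abbreviation dpow :: "nat \<Rightarrow> 'a list" where
  "dpow \<equiv> wp d"

lemma dpow_lists [simp]: "dpow n \<in> lists S"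
  by (simp only: wp_lists Delta_lists)

lemma letter_dv_Delta: "s \<in> S \<Longrightarrow> [s] \<unlhd> d"
  by (simp add: red_dv_Delta red_single)

lemma Delta_complement: "s \<in> S \<Longrightarrow> \<exists>x\<in>lists S. s # x \<sim> d"
  using letter_dv_Delta by (auto simp: dv_def)

text \<open>The complement \<open>x\<close> of \<open>s\<close> in \<Delta> is reduced, so it
  divides \<Delta> in turn; comparison of lengths leaves a single letter \<open>t\<close>.\<close>

lemma twist_exists:
  assumes "s \<in> S"
  shows "\<exists>t\<in>S. s # d \<sim> d @ [t]"
proof -
  obtain x where x: "s # x \<sim> d" using Delta_complement[OF assms] by blast
  then have "red x" using red_Delta peq_red red_ConsD by blast
  then obtain z where z: "z \<in> lists S" "x @ z \<sim> d" using red_dv_Delta by (auto simp: dv_def)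
  then have "length z = 1" using peq_length[OF x] peq_length[OF z(2)] by simp
  then obtain t where t: "z = [t]" by (cases z) auto
  have "s # d \<sim> s # x @ z" using z(2) peq_Cons peq_sym by blast
  also have "s # x @ z \<sim> d @ z" using peq_appendR[OF x, of z] by simp
  finally show ?thesis using z(1) t by auto
qed

definition twist :: "'a \<Rightarrow> 'a" where
  "twist s = (SOME t. t \<in> S \<and> s # d \<sim> d @ [t])"

lemma twist: "s \<in> S \<Longrightarrow> twist s \<in> S \<and> s # d \<sim> d @ [twist s]"
  unfolding twist_def by (rule someI_ex) (use twist_exists in blast)

lemma Delta_rev: "rev d \<sim> d"
  using dv_length_eq[OF red_dv_Delta[OF red_rev[OF red_Delta]]] by simp

text \<open>In the Coxeter group \<Delta> is an involution because it equals its reverse, so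
  conjugating twice by it is trivial there. Matsumoto's theorem lifts this to letters of the monoid,
  where a letter is alone in its class.\<close>

lemma twist_twist:
  assumes s: "s \<in> S"
  shows "twist (twist s) = s"
proof -
  define t where "t = twist s"
  define r where "r = twist t"
  have t: "t \<in> S" "[s] @ d \<approx> d @ [t]" using twist[OF s] peq_ceq by (auto simp: t_def)
  have r: "r \<in> S" "[t] @ d \<approx> d @ [r]" using twist[OF t(1)] peq_ceq by (auto simp: r_def)
  have "d @ d \<approx> []"
  proof -
    have "d @ d \<approx> d @ rev d" using peq_ceq[OF peq_sym[OF Delta_rev]] by (rule ceq_appendL)
    also have "d @ rev d \<approx> []" using Delta_lists by (rule ceq_inv)
    finally show ?thesis .
  qed
  then have dd: "x @ d @ d \<approx> x" "(d @ d) @ x \<approx> x" for x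
    using ceq_appendL[of "d @ d" "[]" x] ceq_appendR[of "d @ d" "[]" x] by simp_all
  have "[s] \<approx> [s] @ d @ d" using dd(1) by (rule cox_eq.sym)
  also have "[s] @ d @ d \<approx> (d @ [t]) @ d" using ceq_appendR[OF t(2), of d] by simp
  also have "(d @ [t]) @ d \<approx> d @ d @ [r]" using ceq_appendL[OF r(2), of d] by simp
  also have "d @ d @ [r] \<approx> [r]" using dd(2)[of "[r]"] by simp
  finally have "[s] \<sim> [r]" using matsumoto red_single s r(1) by blast
  then have "[r] = [s]" by (rule peq_single[OF s])
  then show ?thesis by (simp add: r_def t_def)
qed

lemma map_twist_lists: "x \<in> lists S \<Longrightarrow> map twist x \<in> lists S"
  using twist by auto

lemma append_Delta: "x \<in> lists S \<Longrightarrow> x @ d \<sim> d @ map twist x"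
proof (induction x)
  case (Cons s x)
  then have "s # x @ d \<sim> s # d @ map twist x" using peq_Cons by simp
  also have "s # d @ map twist x \<sim> d @ map twist (s # x)"
    using peq_appendR[of "s # d" "d @ [twist s]" "map twist x"] twist[of s] Cons.prems by simp
  finally show ?case by simp
qed simp

lemma Delta_append: "x \<in> lists S \<Longrightarrow> d @ x \<sim> map twist x @ d"
proof -
  assume x: "x \<in> lists S"
  then have "map twist (map twist x) = x" using twist_twist by (induction x) auto
  then show ?thesis using append_Delta[OF map_twist_lists[OF x]] peq_sym by simp
qed

lemma append_dpow: "x \<in> lists S \<Longrightarrow> \<exists>y\<in>lists S. x @ dpow k \<sim> dpow k @ y"
proof (induction k arbitrary: x)
  case 0
  then show ?case by (intro bexI[of _ x]) auto
next
  case (Suc k)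
  from Suc.IH[OF map_twist_lists[OF Suc.prems]] obtain y
    where y: "y \<in> lists S" "map twist x @ dpow k \<sim> dpow k @ y" by blast
  have "(x @ d) @ dpow k \<sim> (d @ map twist x) @ dpow k"
    using append_Delta[OF Suc.prems] by (rule peq_appendR)
  also have "(d @ map twist x) @ dpow k \<sim> d @ dpow k @ y" using peq_appendL[OF y(2), of d] by simp
  finally show ?case using y(1) by auto
qed

lemma dpow_append: "x \<in> lists S \<Longrightarrow> \<exists>y\<in>lists S. dpow k @ x \<sim> y @ dpow k"
proof (induction k arbitrary: x)
  case 0
  then show ?case by (intro bexI[of _ x]) auto
next
  case (Suc k)
  from Suc.IH[OF Suc.prems] obtain y where y: "y \<in> lists S" "dpow k @ x \<sim> y @ dpow k" by blast
  have "d @ dpow k @ x \<sim> d @ y @ dpow k" using y(2) by (rule peq_appendL)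
  also have "d @ y @ dpow k \<sim> map twist y @ d @ dpow k"
    using peq_appendR[OF Delta_append[OF y(1)], of "dpow k"] by simp
  finally have "dpow (Suc k) @ x \<sim> map twist y @ dpow (Suc k)" by simp
  then show ?case using map_twist_lists[OF y(1)] by blast
qed

lemma dpow_central: "x \<in> lists S \<Longrightarrow> x @ dpow (2 * k) \<sim> dpow (2 * k) @ x"
proof (induction k)
  case (Suc k)
  have tt: "map twist (map twist x) = x" using twist_twist Suc.prems by (induction x) auto
  have "(x @ d) @ d \<sim> (d @ map twist x) @ d" using append_Delta[OF Suc.prems] by (rule peq_appendR)
  also have "(d @ map twist x) @ d \<sim> d @ d @ x"
    using peq_appendL[OF append_Delta[OF map_twist_lists[OF Suc.prems]], of d] tt by simp
  finally have "(x @ d @ d) @ dpow (2 * k) \<sim> (d @ d @ x) @ dpow (2 * k)" by (intro peq_appendR) simp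
  also have "(d @ d @ x) @ dpow (2 * k) \<sim> d @ d @ dpow (2 * k) @ x"
    using peq_appendL[OF Suc.IH[OF Suc.prems], of "d @ d"] by simp
  finally show ?case by simp
qed simp

lemma dpow_mono: "i \<le> j \<Longrightarrow> dpow i \<unlhd> dpow j"
  using wp_add[of i "j - i" d] by simp

section \<open>Greatest common divisors\<close>

text \<open>A longest common divisor \<open>e\<close> works: \<open>x\<close> bounds
  \<open>e\<close> and any other common divisor \<open>f\<close>, so their join exists and is again
  a common divisor. By maximality it cannot be longer than \<open>e\<close>.\<close>

lemma gcd_exists:
  assumes "x \<in> lists S" "y \<in> lists S"
  shows "\<exists>e. e \<unlhd> x \<and> e \<unlhd> y \<and> (\<forall>f. f \<unlhd> x \<and> f \<unlhd> y \<longrightarrow> f \<unlhd> e)"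
proof -
  have "[] \<unlhd> x \<and> [] \<unlhd> y" using assms by simp
  moreover have "\<forall>f. f \<unlhd> x \<and> f \<unlhd> y \<longrightarrow> length f < Suc (length x)" using dv_length by fastforce
  ultimately obtain e where e: "e \<unlhd> x" "e \<unlhd> y" and max: "\<And>f. f \<unlhd> x \<Longrightarrow> f \<unlhd> y \<Longrightarrow> length f \<le> length e"
    using ex_has_greatest_nat[of "\<lambda>f. f \<unlhd> x \<and> f \<unlhd> y" "[]" length "Suc (length x)"] by blast
  have "f \<unlhd> e" if f: "f \<unlhd> x" "f \<unlhd> y" for f
  proof -
    obtain j where j: "e \<unlhd> j" "f \<unlhd> j"
        and least: "\<forall>g\<in>lists S. e \<unlhd> g \<longrightarrow> f \<unlhd> g \<longrightarrow> j \<unlhd> g"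
      using join_exists[OF assms(1) e(1) f(1)] by (elim exE conjE)
    have "j \<unlhd> x" "j \<unlhd> y" using least assms e(1,2) f by simp_all
    then have "e \<sim> j" using max[OF \<open>j \<unlhd> x\<close> \<open>j \<unlhd> y\<close>] j(1) dv_length[OF j(1)] by (intro dv_length_eq) auto
    then show ?thesis using j(2) dv_peq peq_sym by blast
  qed
  with e show ?thesis by blast
qed

definition lgcd :: "'a list \<Rightarrow> 'a list \<Rightarrow> 'a list" where
  "lgcd x y = (SOME e. e \<unlhd> x \<and> e \<unlhd> y \<and> (\<forall>f. f \<unlhd> x \<and> f \<unlhd> y \<longrightarrow> f \<unlhd> e))"

lemma lgcd:
  assumes "x \<in> lists S" "y \<in> lists S"
  shows "lgcd x y \<unlhd> x" "lgcd x y \<unlhd> y" "f \<unlhd> x \<Longrightarrow> f \<unlhd> y \<Longrightarrow> f \<unlhd> lgcd x y"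
  using someI_ex[OF gcd_exists[OF assms]] unfolding lgcd_def by blast+

text \<open>Left multiplication commutes with greatest common divisors, since \<open>u\<close>
  divides the one of u @ x and u @ y and can be cancelled. This makes the recursion for the meets
  below possible.\<close>

lemma dv_append_lgcd:
  assumes lists: "u \<in> lists S" "x \<in> lists S" "y \<in> lists S" and f: "f \<unlhd> u @ x" "f \<unlhd> u @ y"
  shows "f \<unlhd> u @ lgcd x y"
proof -
  have ux: "u @ x \<in> lists S" "u @ y \<in> lists S" using lists by auto
  note e = lgcd[OF ux]
  have "u \<unlhd> lgcd (u @ x) (u @ y)" using e(3) lists by simp
  then obtain z where z: "u @ z \<sim> lgcd (u @ x) (u @ y)" by (auto simp: dv_def)
  then have "z \<unlhd> x" "z \<unlhd> y" using dv_cancelL ux e(1,2) peq_dv by blast+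
  then have "u @ z \<unlhd> u @ lgcd x y" using lgcd(3)[OF lists(2,3)] dv_append_mono by blast
  then show ?thesis using e(3)[OF f] z peq_sym dv_peq dv_trans by blast
qed

section \<open>The monoid embeds in the group\<close>

abbreviation aeq :: "('a \<times> bool) list \<Rightarrow> ('a \<times> bool) list \<Rightarrow> bool" (infix \<open>\<simeq>\<close> 50) where
  "u \<simeq> v \<equiv> artin_eq S m u v"

lemmas aeq_trans [trans] = artin_eq.trans

lemma pos_append [simp]: "pos (u @ v) = pos u @ pos v"
  by (simp add: pos_def)

lemma pos_Nil [simp]: "pos [] = []"
  by (simp add: pos_def)

lemma pos_Cons [simp]: "pos (s # v) = (s, True) # pos v"
  by (simp add: pos_def)

lemma pos_wp: "pos (wp w n) = wp (pos w) n"
  by (induction n) auto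

lemma pos_awords: "pos x \<in> awords S \<longleftrightarrow> x \<in> lists S"
  by (auto simp: awords_def pos_def)

lemma awords_append [simp]: "u @ v \<in> awords S \<longleftrightarrow> u \<in> awords S \<and> v \<in> awords S"
  by (auto simp: awords_def)

lemma aeq_context: "u \<simeq> v \<Longrightarrow> x @ u @ y \<simeq> x @ v @ y"
proof (induction rule: artin_eq.induct)
  case (free s u b w)
  then show ?case using artin_eq.free[of s S m "x @ u" b "w @ y"] by simp
next
  case (braid s t u w)
  then show ?case using artin_eq.braid[of s S t m "x @ u" "w @ y"] by simp
qed (auto intro: artin_eq.intros)

lemma aeq_append: "u \<simeq> v \<Longrightarrow> x \<simeq> y \<Longrightarrow> u @ x \<simeq> v @ y"
  using aeq_context[of u v "[]" x] aeq_context[of x y v "[]"] by (auto intro: artin_eq.trans)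

lemma aeq_appendL: "x \<simeq> y \<Longrightarrow> u @ x \<simeq> u @ y"
  by (simp add: aeq_append artin_eq.refl)

lemma aeq_appendR: "x \<simeq> y \<Longrightarrow> x @ u \<simeq> y @ u"
  by (simp add: aeq_append artin_eq.refl)

lemma aeq_awords: "u \<simeq> v \<Longrightarrow> u \<in> awords S \<longleftrightarrow> v \<in> awords S"
  by (induction rule: artin_eq.induct) (auto simp: awords_def pos_def alt_def)

lemma peq_aeq: "u \<sim> v \<Longrightarrow> pos u \<simeq> pos v"
  unfolding peq_def
proof (induction rule: rtranclp.induct)
  case (rtrancl_into_rtrancl a b c)
  from this(2) have "pos b \<simeq> pos c" by cases (auto intro: artin_eq.braid)
  with rtrancl_into_rtrancl show ?case by (blast intro: artin_eq.trans)
qed (rule artin_eq.refl)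

lemma winv_winv: "winv (winv w) = w"
  by (simp add: winv_def rev_map comp_def case_prod_beta)

lemma winv_awords: "winv w \<in> awords S \<longleftrightarrow> w \<in> awords S"
  by (auto simp: winv_def awords_def)

lemma aeq_inv: "w \<in> awords S \<Longrightarrow> w @ winv w \<simeq> []"
proof (induction w)
  case (Cons x w)
  obtain s b where x: "x = (s, b)" by force
  have "[x] @ (w @ winv w) @ [(s, \<not> b)] \<simeq> [x] @ [] @ [(s, \<not> b)]"
    using Cons by (intro aeq_context) (auto simp: awords_def)
  also have "[x] @ [] @ [(s, \<not> b)] \<simeq> []"
    using artin_eq.free[of s S m "[]" b "[]"] Cons.prems x by (simp add: awords_def)
  finally show ?case by (simp add: winv_def x)
qed (simp add: winv_def artin_eq.refl)

lemma aeq_inv': "w \<in> awords S \<Longrightarrow> winv w @ w \<simeq> []"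
  using aeq_inv[of "winv w"] by (simp add: winv_winv winv_awords)

lemma aeq_cancelR: "u @ w \<simeq> v @ w \<Longrightarrow> w \<in> awords S \<Longrightarrow> u \<simeq> v"
proof -
  assume w: "w \<in> awords S" and uv: "u @ w \<simeq> v @ w"
  have "x \<simeq> x @ w @ winv w" for x using aeq_appendL[OF artin_eq.sym[OF aeq_inv[OF w]], of x] by simp
  moreover have "u @ w @ winv w \<simeq> v @ w @ winv w" using aeq_appendR[OF uv, of "winv w"] by simp
  ultimately show ?thesis by (blast intro: artin_eq.trans artin_eq.sym)
qed

definition compl :: "'a \<Rightarrow> 'a list" where
  "compl s = (SOME x. x \<in> lists S \<and> s # x \<sim> d)"

lemma compl: "s \<in> S \<Longrightarrow> compl s \<in> lists S \<and> s # compl s \<sim> d"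
  unfolding compl_def by (rule someI_ex) (use Delta_complement in blast)

text \<open>A group word \<open>w\<close> with \<open>n\<close> negative letters equals the positive word \<open>clear w\<close> times
  \<open>\<Delta>\<^sup>-\<^sup>2\<^sup>n\<close>; the inverse of a letter \<open>s\<close> is \<open>s\<^sup>*\<Delta>\<^sup>-\<^sup>2\<close> with \<open>s s\<^sup>* = s\<^sup>* s = \<Delta>\<^sup>2\<close>.\<close>

primrec clear :: "('a \<times> bool) list \<Rightarrow> 'a list" where
  "clear [] = []"
| "clear (x # w) = (if snd x then [fst x] else compl (fst x) @ d) @ clear w"

primrec negs :: "('a \<times> bool) list \<Rightarrow> nat" where
  "negs [] = 0"
| "negs (x # w) = (if snd x then 0 else 1) + negs w"

lemma clear_append: "clear (u @ v) = clear u @ clear v"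
  by (induction u) auto

lemma negs_append: "negs (u @ v) = negs u + negs v"
  by (induction u) auto

lemma clear_pos [simp]: "clear (pos w) = w"
  by (induction w) auto

lemma negs_pos [simp]: "negs (pos w) = 0"
  by (induction w) auto

lemma clear_lists: "w \<in> awords S \<Longrightarrow> clear w \<in> lists S"
proof (induction w)
  case (Cons x w)
  then have "clear w \<in> lists S" "fst x \<in> S" by (auto simp: awords_def)
  then show ?case using compl[of "fst x"] Delta_lists by auto
qed simp

lemma dpow_2: "dpow 2 = d @ d"
  by (simp add: numeral_2_eq_2)

lemma clear_cancel:
  assumes "s \<in> S"
  shows "clear [(s, b), (s, \<not> b)] \<sim> d @ d"
proof -
  have 1: "s # compl s @ d \<sim> d @ d" using peq_appendR[of "s # compl s" d d] compl[OF assms] by simp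
  have "[s] @ (compl s @ d @ [s]) \<sim> (d @ d) @ [s]" using peq_appendR[OF 1, of "[s]"] by simp
  also have "(d @ d) @ [s] \<sim> [s] @ d @ d"
    using dpow_central[of "[s]" 1] assms peq_sym by (simp add: dpow_2)
  finally have "[s] @ (compl s @ d @ [s]) \<sim> [s] @ d @ d" .
  moreover have "[s] @ (compl s @ d @ [s]) \<in> lists S" using assms compl[OF assms] Delta_lists by auto
  ultimately have "compl s @ d @ [s] \<sim> d @ d" using peq_cancelL by blast
  with 1 show ?thesis by (cases b) auto
qed

text \<open>This is equality of fractions after cross-multiplication, with central denominators
  \<Delta>^2 for each negative letter. It holds for every defining relation; transitivity multiplies
  by the denominator of the middle word and cancels it on the right.\<close>

lemma aeq_clear:
  "u \<simeq> v \<Longrightarrow> u \<in> awords S \<Longrightarrow> clear u @ dpow (2 * negs v) \<sim> clear v @ dpow (2 * negs u)"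
proof (induction rule: artin_eq.induct)
  case (sym u w)
  then show ?case using aeq_awords peq_sym by blast
next
  case (trans u v w)
  have v: "v \<in> awords S" "w \<in> awords S" using trans aeq_awords by blast+
  define U V W where UVW: "U = dpow (2 * negs u)" "V = dpow (2 * negs v)" "W = dpow (2 * negs w)"
  have c: "U @ V \<sim> V @ U" "V @ W \<sim> W @ V" "U @ W \<sim> W @ U" using dpow_central UVW by auto
  have "(clear u @ W) @ V \<sim> (clear u @ V) @ W" using peq_appendL[OF peq_sym[OF c(2)], of "clear u"] by simp
  also have "(clear u @ V) @ W \<sim> (clear v @ U) @ W"
    using trans.IH(1)[OF trans.prems] UVW by (intro peq_appendR) simp
  also have "(clear v @ U) @ W \<sim> (clear v @ W) @ U" using peq_appendL[OF c(3), of "clear v"] by simp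
  also have "(clear v @ W) @ U \<sim> (clear w @ V) @ U"
    using trans.IH(2)[OF v(1)] UVW by (intro peq_appendR) simp
  also have "(clear w @ V) @ U \<sim> (clear w @ U) @ V" using peq_appendL[OF peq_sym[OF c(1)], of "clear w"] by simp
  finally have "(clear u @ W) @ V \<sim> (clear w @ U) @ V" .
  moreover have "(clear u @ W) @ V \<in> lists S" using clear_lists[OF trans.prems] UVW by simp
  ultimately show ?case using peq_cancelR UVW by blast
next
  case (free s u b w)
  have w: "w \<in> awords S" using free by (simp add: awords_def)
  have "clear u @ clear [(s, b), (s, \<not> b)] @ clear w \<sim> clear u @ dpow (2 * 1) @ clear w"
    using clear_cancel[OF free(1), of b] by (intro peq_context) (simp add: dpow_2)
  also have "clear u @ dpow (2 * 1) @ clear w \<sim> clear u @ clear w @ dpow (2 * 1)"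
    using peq_appendL[OF peq_sym[OF dpow_central[OF clear_lists[OF w]]]] .
  finally have "clear (u @ [(s, b), (s, \<not> b)] @ w) @ dpow (2 * negs (u @ w)) \<sim>
      (clear u @ clear w @ dpow 2) @ dpow (2 * negs (u @ w))"
    by (intro peq_appendR) (simp only: clear_append mult_1_right)
  also have "\<dots> = clear (u @ w) @ dpow (2 + 2 * negs (u @ w))"
    unfolding clear_append wp_add by simp
  also have "2 + 2 * negs (u @ w) = 2 * negs (u @ [(s, b), (s, \<not> b)] @ w)"
    by (simp add: negs_append)
  finally show ?case .
next
  case (braid s t u w)
  then have "clear u @ alt s t (m s t) @ clear w \<sim> clear u @ alt t s (m s t) @ clear w"
    by (intro peq_context peq_alt)
  from peq_appendR[OF this, of "dpow (2 * negs u + 2 * negs w)"] show ?case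
    by (simp add: clear_append negs_append)
qed simp

text \<open>Positive words have denominator 1 and are fixed by \<open>clear\<close>, so
  \<open>aeq_clear\<close> gives the embedding of the monoid.\<close>

theorem aeq_pos_iff: "x \<in> lists S \<Longrightarrow> pos x \<simeq> pos y \<longleftrightarrow> x \<sim> y"
  using aeq_clear[of "pos x" "pos y"] peq_aeq pos_awords by auto

lemma apref_iff: "y \<in> lists S \<Longrightarrow> apref S m x y \<longleftrightarrow> x \<unlhd> y"
  unfolding apref_def dv_def using aeq_pos_iff peq_sym by blast

lemma clear_aeq: "w \<in> awords S \<Longrightarrow> w @ pos (dpow (2 * negs w)) \<simeq> pos (clear w)"
proof (induction w)
  case (Cons x w)
  obtain s b where x: "x = (s, b)" by force
  have s: "s \<in> S" and w: "w \<in> awords S" using Cons.prems x by (auto simp: awords_def)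
  note IH = Cons.IH[OF w]
  show ?case
  proof (cases b)
    case True
    then show ?thesis using aeq_appendL[OF IH, of "[x]"] by (simp add: x)
  next
    case False
    have "[x] @ (w @ pos (dpow (2 * negs w))) @ pos (dpow 2) \<simeq> [x] @ pos (clear w) @ pos (dpow 2)"
      using IH by (rule aeq_context)
    also have "pos (clear w) @ pos (dpow 2) \<simeq> pos (s # compl s @ d @ clear w)"
    proof -
      have "clear w @ dpow (2 * 1) \<sim> dpow (2 * 1) @ clear w" using clear_lists[OF w] by (rule dpow_central)
      also have "dpow (2 * 1) @ clear w \<sim> s # compl s @ d @ clear w"
        using peq_appendR[OF peq_sym[of "s # compl s" d], of "d @ clear w"] compl[OF s] by (simp add: dpow_2)
      finally have "pos (clear w @ dpow (2 * 1)) \<simeq> pos (s # compl s @ d @ clear w)" by (rule peq_aeq)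
      then show ?thesis by simp
    qed
    then have "[x] @ pos (clear w) @ pos (dpow 2) \<simeq> [x] @ pos (s # compl s @ d @ clear w)"
      by (rule aeq_appendL)
    also have "[x] @ pos (s # compl s @ d @ clear w) \<simeq> pos (compl s @ d @ clear w)"
      using artin_eq.free[OF s, of m "[]" False "pos (compl s @ d @ clear w)"] False x by simp
    finally have "[x] @ (w @ pos (dpow (2 * negs w))) @ pos (dpow 2) \<simeq> pos (compl s @ d @ clear w)" .
    then show ?thesis using False x wp_add[of "2 * negs w" 2 d] by (simp add: dpow_2 del: replicate_add)
  qed
qed (simp add: artin_eq.refl)

end

section \<open>Subadditive sequences\<close>

lemma subadditive_multiple:
  fixes f :: "nat \<Rightarrow> nat"
  assumes "\<And>i j. f (i + j) \<le> f i + f j"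
  shows "f (q * N + r) \<le> q * f N + f r"
proof (induction q)
  case (Suc q)
  have "f (Suc q * N + r) \<le> f N + f (q * N + r)" using assms[of N "q * N + r"] by (simp add: add.assoc)
  with Suc show ?case by simp
qed simp

text \<open>The limit is the infimum of the quotients. Convergence is what gives \<open>lim\<close>
  in \<open>translation_length\<close> its intended value.\<close>

lemma fekete:
  fixes f :: "nat \<Rightarrow> nat"
  assumes sub: "\<And>i j. f (i + j) \<le> f i + f j"
  shows "\<exists>L. (\<lambda>n. real (f n) / real n) \<longlonglongrightarrow> L"
proof
  define A where "A = (\<lambda>n. real (f n) / real n) ` {1..}"
  define L where "L = Inf A"
  have bdd: "bdd_below A" by (intro bdd_belowI[of _ 0]) (auto simp: A_def)
  show "(\<lambda>n. real (f n) / real n) \<longlonglongrightarrow> L"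
  proof (rule LIMSEQ_I)
    fix e :: real assume e: "e > 0"
    have "Inf A < L + e / 2" using e by (simp add: L_def)
    moreover have "A \<noteq> {}" by (auto simp: A_def)
    ultimately obtain N where N: "N \<ge> 1" "f N / N < L + e / 2"
      using cInf_less_iff[OF _ bdd] by (auto simp: A_def)
    define C where "C = Max (f ` {..<N})"
    have upper: "f n / n \<le> f N / N + C / n" if n: "n \<ge> 1" for n
    proof -
      have "f (n mod N) \<le> C" using N(1) by (auto simp: C_def intro!: Max_ge)
      then have "f n \<le> (n div N) * f N + C"
        using subadditive_multiple[of f "n div N" N "n mod N", OF sub] by simp
      then have "real (f n) \<le> real (n div N) * f N + C"
        by (metis of_nat_add of_nat_le_iff of_nat_mult)
      also have "real (n div N) * f N \<le> (n / N) * f N"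
        by (intro mult_right_mono of_nat_div_le_of_nat) simp
      finally show ?thesis using n by (simp add: field_simps)
    qed
    obtain M :: nat where M: "2 * C / e < M" using reals_Archimedean2 by blast
    show "\<exists>no. \<forall>n\<ge>no. norm (real (f n) / real n - L) < e"
    proof (intro exI[of _ "max 1 M"] allI impI)
      fix n assume "max 1 M \<le> n"
      then have n: "n \<ge> 1" "M \<le> n" by auto
      then have "2 * C / e < n" using M by linarith
      then have "C / n < e / 2" using n e by (simp add: field_simps)
      then have "f n / n < L + e" using upper[OF n(1)] N(2) by linarith
      moreover have "L \<le> f n / n"
        unfolding L_def using n(1) bdd by (intro cInf_lower) (auto simp: A_def)
      ultimately show "norm (real (f n) / real n - L) < e" using e by simp
    qed
  qed
qed

text \<open>For \<open>k\<close> beyond the values at small indices, the index \<open>i\<close> is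
  itself large. Then f (r * i) \<ge> k \<ge> i keeps the quotient at r * i at least 1 / r for
  arbitrarily large indices.\<close>

lemma lim_ge_of_frequent_growth:
  fixes f :: "nat \<Rightarrow> nat"
  assumes lim: "(\<lambda>n. real (f n) / real n) \<longlonglongrightarrow> L" and r: "r > 0"
    and growth: "\<And>k. \<exists>i\<le>k. f (r * i) \<ge> k"
  shows "L \<ge> 1 / real r"
proof (rule ccontr)
  assume "\<not> L \<ge> 1 / real r"
  then have "\<forall>\<^sub>F n in sequentially. real (f n) / real n < 1 / real r"
    using order_tendstoD(2)[OF lim] by simp
  then obtain N where N: "\<And>n. n \<ge> N \<Longrightarrow> real (f n) / real n < 1 / real r"
    by (auto simp: eventually_sequentially)
  define C where "C = Max ((\<lambda>i. f (r * i)) ` {..N})"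
  obtain i where i: "i \<le> Suc C" "f (r * i) \<ge> Suc C" using growth by blast
  have "i > N"
  proof (rule ccontr)
    assume "\<not> i > N"
    then have "f (r * i) \<le> C" unfolding C_def by (intro Max_ge) auto
    with i show False by simp
  qed
  moreover have "i \<le> r * i" using r by simp
  ultimately have "real (f (r * i)) / real (r * i) < 1 / real r" by (intro N) linarith
  then have "real (f (r * i)) < real i" using r \<open>i > N\<close> by (simp add: field_simps)
  with i show False by simp
qed

context finite_type_coxeter
begin

section \<open>Normal forms and the word norm\<close>

text \<open>The atoms are the divisors of \<Delta>, so \<alpha>(g) is the greatest common divisor of
  \<open>g\<close> and \<Delta>.\<close>

lemma alpha_exists:
  assumes g: "g \<in> lists S"
  shows "\<exists>a. red a \<and> a \<unlhd> g \<and> (\<forall>b. red b \<and> b \<unlhd> g \<longrightarrow> b \<unlhd> a)"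
proof (intro exI[of _ "lgcd g d"] conjI allI impI)
  note e = lgcd[OF g Delta_lists]
  show "red (lgcd g d)" using dv_red[OF e(2) red_Delta] .
  show "lgcd g d \<unlhd> g" by (rule e)
  show "b \<unlhd> lgcd g d" if "red b \<and> b \<unlhd> g" for b using that e(3) red_dv_Delta by blast
qed

lemma is_alpha_iff:
  "g \<in> lists S \<Longrightarrow> is_alpha S m a g \<longleftrightarrow> red a \<and> a \<unlhd> g \<and> (\<forall>b. red b \<and> b \<unlhd> g \<longrightarrow> b \<unlhd> a)"
  unfolding is_alpha_def using apref_iff red_lists by blast

lemma normal_form_lists: "normal_form S m As g \<Longrightarrow> g \<in> lists S \<Longrightarrow> concat As \<in> lists S \<and> concat As \<sim> g"
  unfolding normal_form_def
  using aeq_awords[of "pos (concat As)" "pos g"] pos_awords aeq_pos_iff by blast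

lemma normal_form_exists: "g \<in> lists S \<Longrightarrow> \<exists>As. normal_form S m As g"
proof (induction "length g" arbitrary: g rule: less_induct)
  case less
  show ?case
  proof (cases g)
    case Nil
    then show ?thesis by (intro exI[of _ "[]"]) (simp add: normal_form_def artin_eq.refl)
  next
    case (Cons s h)
    obtain a where a: "red a" "a \<unlhd> g" "\<And>b. red b \<Longrightarrow> b \<unlhd> g \<Longrightarrow> b \<unlhd> a"
      using alpha_exists[OF less.prems] by blast
    have "[s] \<unlhd> a" using a(3)[of "[s]"] less.prems Cons dv_append[of h "[s]"] red_single by simp
    then have a_nontriv: "length a \<ge> 1" using dv_length by fastforce
    obtain g' where g': "g' \<in> lists S" "a @ g' \<sim> g" using a(2) by (auto simp: dv_def)
    then have "length g' < length g" using peq_length[OF g'(2)] a_nontriv by simp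
    then obtain As where As: "normal_form S m As g'" using less.hyps g'(1) by blast
    have cAs: "concat As \<in> lists S" "concat As \<sim> g'" using normal_form_lists[OF As g'(1)] by auto
    have eq: "a @ concat As \<sim> g" using peq_appendL[OF cAs(2)] g'(2) by (rule peq_trans)
    have lists: "a @ concat As \<in> lists S" using cAs red_lists[OF a(1)] by simp
    have "is_alpha S m a (a @ concat As)"
      unfolding is_alpha_iff[OF lists] using a eq dv_peq peq_sym by blast
    moreover have "\<not> pos a \<simeq> []"
      using aeq_pos_iff[OF red_lists[OF a(1)], of "[]"] a_nontriv peq_length[of a "[]"] by auto
    moreover have "pos (concat (a # As)) \<simeq> pos g" using peq_aeq[OF eq] by simp
    ultimately have "normal_form S m (a # As) g"
      using As a(1) unfolding normal_form_def by (auto simp: nth_Cons' drop_Cons' less_Suc_eq_0_disj)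
    then show ?thesis by blast
  qed
qed

context
  assumes Delta_nontrivial: "d \<noteq> []"
begin

lemma Delta_dv_middle: "x \<in> lists S \<Longrightarrow> y \<in> lists S \<Longrightarrow> d \<unlhd> x @ d @ y"
proof -
  assume x: "x \<in> lists S" and y: "y \<in> lists S"
  then have "d \<unlhd> d @ map twist x @ y" using map_twist_lists by simp
  moreover have "d @ map twist x @ y \<sim> x @ d @ y"
    using peq_appendR[OF peq_sym[OF append_Delta[OF x]], of y] by simp
  ultimately show ?thesis by (rule dv_peq)
qed

text \<open>If \<Delta> divides \<open>p\<close>, the greedy first factor is \<Delta>. Conversely, a
  factor \<Delta> at any place moves to the front by the twist.\<close>

lemma Delta_free_iff:
  assumes p: "p \<in> lists S"
  shows "(\<exists>As. normal_form S m As p \<and> (\<forall>A\<in>set As. \<not> pos A \<simeq> pos d)) \<longleftrightarrow> \<not> d \<unlhd> p"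
proof
  assume "\<exists>As. normal_form S m As p \<and> (\<forall>A\<in>set As. \<not> pos A \<simeq> pos d)"
  then obtain As where As: "normal_form S m As p" "\<forall>A\<in>set As. \<not> pos A \<simeq> pos d" by blast
  note cAs = normal_form_lists[OF As(1) p, THEN conjunct1] normal_form_lists[OF As(1) p, THEN conjunct2]
  show "\<not> d \<unlhd> p"
  proof
    assume "d \<unlhd> p"
    then have dv: "d \<unlhd> concat As" using cAs(2) dv_peq peq_sym by blast
    show False
    proof (cases As)
      case Nil
      then show False using dv_length[OF dv] Delta_nontrivial by simp
    next
      case (Cons A Bs)
      then have "is_alpha S m A (concat As)" using As(1) by (auto simp: normal_form_def)
      then have A: "red A" "d \<unlhd> A" using is_alpha_iff[OF cAs(1)] dv red_Delta by blast+
      then have "length A = length d" using dv_length red_dv_Delta by (simp add: le_antisym)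
      then have "A \<sim> d" using dv_length_eq red_dv_Delta A(1) by blast
      then show False using As(2) Cons peq_aeq by auto
    qed
  qed
next
  assume no: "\<not> d \<unlhd> p"
  obtain As where As: "normal_form S m As p" using normal_form_exists[OF p] by blast
  have "\<not> pos A \<simeq> pos d" if "A \<in> set As" for A
  proof
    assume "pos A \<simeq> pos d"
    moreover have "red A" using As that by (auto simp: normal_form_def)
    ultimately have A: "A \<sim> d" using aeq_pos_iff[OF red_lists] by blast
    obtain Bs Cs where BC: "As = Bs @ A # Cs" using split_list[OF \<open>A \<in> set As\<close>] by blast
    have cAs: "concat As \<in> lists S" "concat As \<sim> p" using normal_form_lists[OF As p] by auto
    then have "d \<unlhd> concat Bs @ d @ concat Cs" using BC by (intro Delta_dv_middle) auto
    also have "concat Bs @ d @ concat Cs \<unlhd> concat Bs @ A @ concat Cs"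
      using peq_context[OF peq_sym[OF A]] by (rule peq_imp_dv)
    also have "concat Bs @ A @ concat Cs \<unlhd> p" using cAs(2) BC by (intro peq_imp_dv) simp
    finally show False using no by blast
  qed
  with As show "\<exists>As. normal_form S m As p \<and> (\<forall>A\<in>set As. \<not> pos A \<simeq> pos d)" by blast
qed

section \<open>The exponent of \<Delta> in a positive word\<close>

definition inf_exp :: "'a list \<Rightarrow> nat" where
  "inf_exp g = (GREATEST k. dpow k \<unlhd> g)"

lemma dpow_dv_bound: "dpow k \<unlhd> g \<Longrightarrow> k \<le> length g"
proof -
  assume "dpow k \<unlhd> g"
  then have "k * length d \<le> length g" using dv_length[of "dpow k" g] by (simp add: wp_length)
  moreover have "k \<le> k * length d" using Delta_nontrivial by (cases d) auto
  ultimately show ?thesis by (rule le_trans[rotated])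
qed

lemma dpow_inf_exp: "g \<in> lists S \<Longrightarrow> dpow (inf_exp g) \<unlhd> g"
  unfolding inf_exp_def by (rule GreatestI_nat[of _ 0 "length g"]) (auto intro: dpow_dv_bound)

lemma inf_exp_ge: "dpow k \<unlhd> g \<Longrightarrow> k \<le> inf_exp g"
  unfolding inf_exp_def by (rule Greatest_le_nat[of _ _ "length g"]) (auto intro: dpow_dv_bound)

definition nrm :: "'a list \<Rightarrow> nat" where
  "nrm g = length g - inf_exp g * length d"

lemma nrm_inf_exp: "g \<in> lists S \<Longrightarrow> nrm g + inf_exp g * length d = length g"
  unfolding nrm_def using dv_length[OF dpow_inf_exp, of g] by (simp add: wp_length)

text \<open>The powers of \<Delta> dividing \<open>x\<close> and \<open>y\<close> can be collected
  at the left of the product, so \<open>inf_exp\<close> is superadditive while length is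
  additive.\<close>

lemma nrm_subadditive:
  assumes x: "x \<in> lists S" and y: "y \<in> lists S"
  shows "nrm (x @ y) \<le> nrm x + nrm y"
proof -
  define i j where "i = inf_exp x" and "j = inf_exp y"
  obtain x' where x': "x' \<in> lists S" "dpow i @ x' \<sim> x"
    using dpow_inf_exp[OF x] by (auto simp: dv_def i_def)
  obtain x'' where x'': "x'' \<in> lists S" "x' @ dpow j \<sim> dpow j @ x''" using append_dpow[OF x'(1)] by blast
  have "dpow (i + j) \<unlhd> dpow i @ dpow j @ x''" using dv_append[OF x''(1), of "dpow (i + j)"] wp_add[of i j d] by simp
  also have "dpow i @ dpow j @ x'' \<unlhd> dpow i @ x' @ dpow j"
    using peq_appendL[OF peq_sym[OF x''(2)]] by (rule peq_imp_dv)
  also have "dpow i @ x' @ dpow j \<unlhd> x @ dpow j"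
    using peq_appendR[OF x'(2), of "dpow j"] by (intro peq_imp_dv) simp
  also have "x @ dpow j \<unlhd> x @ y" using dpow_inf_exp[OF y] unfolding j_def by (rule dv_append_mono)
  finally have "(i + j) * length d \<le> inf_exp (x @ y) * length d" using inf_exp_ge by simp
  then show ?thesis
    using nrm_inf_exp[OF x] nrm_inf_exp[OF y] nrm_inf_exp[of "x @ y"] x y
    by (simp add: i_def j_def algebra_simps)
qed

section \<open>Cosets of \<Delta> and their special representatives\<close>

lemma coset_shift_nonneg:
  assumes "pos p \<simeq> x @ wpow (pos d) k"
  shows "\<exists>e f. pos (p @ dpow e) \<simeq> x @ pos (dpow f)"
proof (cases "k \<ge> 0")
  case True
  then have "pos (p @ dpow 0) \<simeq> x @ pos (dpow (nat k))" using assms by (simp add: wpow_def pos_wp)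
  then show ?thesis by blast
next
  case False
  define n where "n = nat (- k)"
  have "wp (winv (pos d)) n @ wp (pos d) n \<simeq> []"
  proof (induction n)
    case (Suc n)
    have "wp (winv (pos d)) n @ (winv (pos d) @ pos d) @ wp (pos d) n \<simeq> wp (winv (pos d)) n @ [] @ wp (pos d) n"
      by (intro aeq_context aeq_inv') (simp add: pos_awords)
    also have "wp (winv (pos d)) n @ [] @ wp (pos d) n \<simeq> []" using Suc by simp
    finally show ?case using wp_add[of n 1 "winv (pos d)"] by simp
  qed (simp add: artin_eq.refl)
  then have "x @ wp (winv (pos d)) n @ wp (pos d) n \<simeq> x @ []" by (rule aeq_appendL)
  moreover have "pos p @ wp (pos d) n \<simeq> (x @ wp (winv (pos d)) n) @ wp (pos d) n"
    using assms False by (intro aeq_appendR) (simp add: wpow_def n_def)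
  ultimately have "pos (p @ dpow n) \<simeq> x @ pos (dpow 0)" by (auto simp: pos_wp intro: artin_eq.trans)
  then show ?thesis by blast
qed

lemma wpow_of_shift:
  assumes "u @ pos (dpow e) \<simeq> x @ pos (dpow f)"
  shows "u \<simeq> x @ wpow (pos d) (int f - int e)"
proof (cases "e \<le> f")
  case True
  then have "dpow f = dpow (f - e) @ dpow e" using wp_add[of "f - e" e d] by simp
  then have "u @ pos (dpow e) \<simeq> (x @ pos (dpow (f - e))) @ pos (dpow e)" using assms by simp
  then have "u \<simeq> x @ pos (dpow (f - e))" by (rule aeq_cancelR) (simp add: pos_awords)
  then show ?thesis using True by (simp add: wpow_def pos_wp nat_diff_distrib)
next
  case False
  define n where "n = e - f"
  have inv: "wp (pos d) n @ wp (winv (pos d)) n \<simeq> []"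
  proof (induction n)
    case (Suc n)
    have "wp (pos d) n @ (pos d @ winv (pos d)) @ wp (winv (pos d)) n \<simeq> wp (pos d) n @ [] @ wp (winv (pos d)) n"
      by (intro aeq_context aeq_inv) (simp add: pos_awords)
    also have "wp (pos d) n @ [] @ wp (winv (pos d)) n \<simeq> []" using Suc by simp
    finally show ?case using wp_add[of n 1 "pos d"] by simp
  qed (simp add: artin_eq.refl)
  have "dpow e = dpow n @ dpow f" using wp_add[of n f d] False by (simp add: n_def)
  then have "(u @ pos (dpow n)) @ pos (dpow f) \<simeq> x @ pos (dpow f)" using assms by simp
  then have "u @ pos (dpow n) \<simeq> x" by (rule aeq_cancelR) (simp add: pos_awords)
  then have "u @ wp (pos d) n @ wp (winv (pos d)) n \<simeq> x @ wp (winv (pos d)) n"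
    using aeq_appendR[of "u @ pos (dpow n)" x] by (simp add: pos_wp)
  moreover have "u @ wp (pos d) n @ wp (winv (pos d)) n \<simeq> u @ []" using inv by (rule aeq_appendL)
  ultimately have "u \<simeq> x @ wp (winv (pos d)) n" by (auto intro: artin_eq.trans artin_eq.sym)
  moreover have "nat (int e - int f) = n" "\<not> int f - int e \<ge> 0" using False by (auto simp: n_def)
  ultimately show ?thesis by (simp add: wpow_def)
qed

lemma special_iff:
  assumes g: "g \<in> lists S" and x: "x @ pos (dpow (2 * q)) \<simeq> pos g"
  shows "special S m d p x \<longleftrightarrow> p \<in> lists S \<and> \<not> d \<unlhd> p \<and> (\<exists>e f. p @ dpow e \<sim> g @ dpow f)"
proof -
  define D where "D = dpow (2 * q)"
  have xf: "(x @ pos (dpow f)) @ pos D \<simeq> pos (g @ dpow f)" for f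
  proof -
    have "dpow f @ D \<sim> D @ dpow f" unfolding D_def by (simp add: dpow_central)
    then have "x @ pos (dpow f @ D) \<simeq> x @ pos (D @ dpow f)" by (intro aeq_appendL peq_aeq)
    then have "x @ pos (dpow f @ D) \<simeq> (x @ pos D) @ pos (dpow f)" by simp
    also have "(x @ pos D) @ pos (dpow f) \<simeq> pos g @ pos (dpow f)" using x D_def by (intro aeq_appendR) simp
    finally show ?thesis by simp
  qed
  have "(\<exists>k. pos p \<simeq> x @ wpow (pos d) k) \<longleftrightarrow> (\<exists>e f. p @ dpow e \<sim> g @ dpow f)" if p: "p \<in> lists S"
  proof
    assume "\<exists>k. pos p \<simeq> x @ wpow (pos d) k"
    then obtain e f where "pos (p @ dpow e) \<simeq> x @ pos (dpow f)" using coset_shift_nonneg by blast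
    then have "pos (p @ dpow e) @ pos D \<simeq> (x @ pos (dpow f)) @ pos D" by (rule aeq_appendR)
    also note xf
    finally have "pos (p @ dpow (e + 2 * q)) \<simeq> pos (g @ dpow f)" by (simp add: wp_add D_def)
    moreover have "p @ dpow (e + 2 * q) \<in> lists S" using p by simp
    ultimately have "p @ dpow (e + 2 * q) \<sim> g @ dpow f" using aeq_pos_iff by blast
    then show "\<exists>e f. p @ dpow e \<sim> g @ dpow f" by blast
  next
    assume "\<exists>e f. p @ dpow e \<sim> g @ dpow f"
    then obtain e f where "p @ dpow e \<sim> g @ dpow f" by blast
    then have "pos (p @ dpow e) \<simeq> pos (g @ dpow f)" by (rule peq_aeq)
    also have "pos (g @ dpow f) \<simeq> (x @ pos (dpow f)) @ pos D" using xf by (rule artin_eq.sym)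
    also have "(x @ pos (dpow f)) @ pos D = x @ pos (dpow (f + 2 * q))" by (simp add: wp_add D_def)
    finally have "pos p @ pos (dpow e) \<simeq> x @ pos (dpow (f + 2 * q))" by simp
    from wpow_of_shift[OF this] show "\<exists>k. pos p \<simeq> x @ wpow (pos d) k" by blast
  qed
  then show ?thesis unfolding special_def using Delta_free_iff by blast
qed

lemma Delta_dv_append_dpow: "y \<in> lists S \<Longrightarrow> k > 0 \<Longrightarrow> d \<unlhd> y @ dpow k"
  using Delta_dv_middle[of y "dpow (k - 1)"] by (cases k) simp_all

text \<open>After cancellation on the right, unequal exponents would leave a positive power of
  \<Delta> on one side, and it moves to the front of a word that \<Delta> does not divide.\<close>

lemma Delta_free_factor_unique:
  assumes lists: "p \<in> lists S" "y \<in> lists S" and free: "\<not> d \<unlhd> p" "\<not> d \<unlhd> y"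
    and eq: "p @ dpow e \<sim> y @ dpow f"
  shows "p \<sim> y"
proof -
  consider "e = f" | "e < f" | "f < e" by linarith
  then show ?thesis
  proof cases
    case 1
    then show ?thesis using eq lists peq_cancelR[of p "dpow e" y] by simp
  next
    case 2
    then have "dpow f = dpow (f - e) @ dpow e" using wp_add[of "f - e" e d] by simp
    then have "p \<sim> y @ dpow (f - e)" using eq lists peq_cancelR[of p "dpow e" "y @ dpow (f - e)"] by simp
    moreover have "d \<unlhd> y @ dpow (f - e)" using 2 lists(2) by (intro Delta_dv_append_dpow) auto
    ultimately show ?thesis using free(1) dv_peq[OF _ peq_sym] by blast
  next
    case 3
    then have "dpow e = dpow (e - f) @ dpow f" using wp_add[of "e - f" f d] by simp
    then have "p @ dpow (e - f) \<sim> y" using eq lists peq_cancelR[of "p @ dpow (e - f)" "dpow f" y] by simp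
    moreover have "d \<unlhd> p @ dpow (e - f)" using 3 lists(1) by (intro Delta_dv_append_dpow) auto
    ultimately show ?thesis using free(2) dv_peq by blast
  qed
qed

text \<open>Splitting off the largest power of \<Delta> leaves the special representative. Its
  uniqueness up to equivalence fixes the length and makes the \<open>THE\<close> in
  \<open>wordnorm\<close> well defined.\<close>

lemma wordnorm_eq_nrm:
  assumes g: "g \<in> lists S" and x: "x @ pos (dpow (2 * q)) \<simeq> pos g"
  shows "wordnorm S m d x = nrm g"
proof -
  define k where "k = inf_exp g"
  obtain z where z: "z \<in> lists S" "dpow k @ z \<sim> g"
    using dpow_inf_exp[OF g] by (auto simp: dv_def k_def)
  \<comment> \<open>The exponent is measured by left division, but the cosets absorb powers of
    \<Delta> on the right, so the power is moved across.\<close>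
  obtain y where y: "y \<in> lists S" "dpow k @ z \<sim> y @ dpow k" using dpow_append[OF z(1)] by blast
  have yg: "y @ dpow k \<sim> g" using y(2) z(2) by (blast intro: peq_trans peq_sym)
  have free: "\<not> d \<unlhd> y"
  proof
    assume "d \<unlhd> y"
    then obtain v where v: "v \<in> lists S" "d @ v \<sim> y" by (auto simp: dv_def)
    obtain v' where v': "v' \<in> lists S" "v @ dpow k \<sim> dpow k @ v'" using append_dpow[OF v(1)] by blast
    have "dpow (Suc k) \<unlhd> d @ dpow k @ v'" using dv_append[OF v'(1), of "dpow (Suc k)"] by simp
    also have "d @ dpow k @ v' \<unlhd> d @ v @ dpow k"
      using peq_appendL[OF peq_sym[OF v'(2)]] by (rule peq_imp_dv)
    also have "d @ v @ dpow k \<unlhd> g"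
      using peq_appendR[OF v(2), of "dpow k"] yg by (auto intro: peq_imp_dv peq_trans)
    finally show False using inf_exp_ge[of "Suc k" g] by (simp add: k_def)
  qed
  have "special S m d y x"
    unfolding special_iff[OF g x]
  proof (intro conjI exI)
    show "y @ dpow k \<sim> g @ dpow 0" using yg by simp
  qed (use y free in auto)
  moreover have "length p = length y" if "special S m d p x" for p
  proof -
    obtain e f where p: "p \<in> lists S" "\<not> d \<unlhd> p" "p @ dpow e \<sim> g @ dpow f"
      using \<open>special S m d p x\<close> unfolding special_iff[OF g x] by blast
    have "g @ dpow f \<sim> (y @ dpow k) @ dpow f" using peq_sym[OF yg] by (rule peq_appendR)
    then have "p @ dpow e \<sim> y @ dpow (k + f)" using p(3) by (auto simp: wp_add intro: peq_trans)
    then have "p \<sim> y" using Delta_free_factor_unique p y(1) free by blast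
    then show ?thesis by (rule peq_length)
  qed
  ultimately have "\<And>n. (\<exists>p. special S m d p x \<and> length p = n) \<longleftrightarrow> n = length y" by metis
  then have "wordnorm S m d x = length y" unfolding wordnorm_def by simp
  also have "length y = nrm g" using peq_length[OF yg] by (simp add: nrm_def k_def wp_length)
  finally show ?thesis .
qed

section \<open>Growth of the word norm\<close>

text \<open>\<open>orbit_meet P q k\<close> is, up to the central factor \<open>\<Delta>\<^sup>2\<^sup>q\<^sup>k\<close>, the meet of
  \<open>1, c, \<dots>, c\<^sup>k\<close> for \<open>c = P\<Delta>\<^sup>-\<^sup>2\<^sup>q\<close>.\<close>

primrec orbit_meet :: "'a list \<Rightarrow> nat \<Rightarrow> nat \<Rightarrow> 'a list" where
  "orbit_meet P q 0 = []"
| "orbit_meet P q (Suc k) = lgcd (dpow (2 * (q * Suc k))) (P @ orbit_meet P q k)"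

lemma orbit_meet_lists: "P \<in> lists S \<Longrightarrow> orbit_meet P q k \<in> lists S"
proof (induction k)
  case (Suc k)
  then have "P @ orbit_meet P q k \<in> lists S" by simp
  from dv_lists[OF lgcd(1)[OF dpow_lists this] dpow_lists] show ?case by simp
qed simp

text \<open>This is y_(k+1) \<le> y_k for the meets in the group. It starts from y_1 \<le> 1 and
  propagates because y \<mapsto> 1 \<sqinter> c y is monotone; the factor \<Delta>^(2q) accounts for
  the different scalings of the two meets.\<close>

lemma orbit_meet_decreasing:
  assumes P: "P \<in> lists S"
  shows "orbit_meet P q (Suc k) \<unlhd> dpow (2 * q) @ orbit_meet P q k"
proof (induction k)
  case 0
  show ?case using lgcd(1)[of "dpow (2 * q)" "P"] P by simp
next
  case (Suc k)
  let ?x = "dpow (2 * (q * Suc k))" and ?y = "P @ orbit_meet P q k"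
  have lists: "orbit_meet P q k \<in> lists S" "?y \<in> lists S" "P @ orbit_meet P q (Suc k) \<in> lists S"
    using P orbit_meet_lists[OF P, of q k] orbit_meet_lists[OF P, of q "Suc k"] by auto
  define e where "e = orbit_meet P q (Suc (Suc k))"
  have "e = lgcd (dpow (2 * (q * Suc (Suc k)))) (P @ orbit_meet P q (Suc k))" by (simp add: e_def)
  then have e: "e \<unlhd> dpow (2 * (q * Suc (Suc k)))" "e \<unlhd> P @ orbit_meet P q (Suc k)"
    using lgcd(1,2)[OF dpow_lists lists(3)] by auto
  have "dpow (2 * (q * Suc (Suc k))) = dpow (2 * q) @ ?x"
    unfolding wp_add[symmetric] by (simp add: algebra_simps)
  then have 1: "e \<unlhd> dpow (2 * q) @ ?x" using e(1) by simp
  note e(2)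
  also have "P @ orbit_meet P q (Suc k) \<unlhd> P @ dpow (2 * q) @ orbit_meet P q k"
    using Suc by (rule dv_append_mono)
  also have "P @ dpow (2 * q) @ orbit_meet P q k \<unlhd> dpow (2 * q) @ ?y"
    using peq_appendR[OF dpow_central[OF P, of q], of "orbit_meet P q k"] by (intro peq_imp_dv) simp
  finally have 2: "e \<unlhd> dpow (2 * q) @ ?y" .
  have "e \<unlhd> dpow (2 * q) @ lgcd ?x ?y"
    using dv_append_lgcd[OF dpow_lists dpow_lists lists(2) 1 2] .
  then show ?case by (simp add: e_def)
qed

text \<open>The meet divides both \<open>P @ ?G\<close> and the word with \<Delta>^(2q) in place of
  \<open>P\<close>, and these have equal length. If it reached that length both would be equivalent
  to it, and cancelling \<open>?G\<close> would give P \<sim> \<Delta>^(2q). So every step loses at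
  least one letter.\<close>

lemma orbit_meet_length:
  assumes P: "P \<in> lists S" "length P = 2 * q * length d" "\<not> P \<sim> dpow (2 * q)"
  shows "length (orbit_meet P q k) + k \<le> 2 * q * length d * k"
proof (induction k)
  case (Suc k)
  let ?G = "orbit_meet P q k" and ?G' = "orbit_meet P q (Suc k)"
  have lists: "?G \<in> lists S" "P @ ?G \<in> lists S" using P orbit_meet_lists by auto
  note dec = orbit_meet_decreasing[OF P(1), of q k]
  have "length ?G' \<noteq> length (P @ ?G)"
  proof
    assume len: "length ?G' = length (P @ ?G)"
    moreover have "?G' \<unlhd> P @ ?G" using lgcd(2)[OF dpow_lists lists(2)] by simp
    ultimately have "?G' \<sim> P @ ?G" by (intro dv_length_eq)
    moreover have "?G' \<sim> dpow (2 * q) @ ?G" using dec len P(2) by (intro dv_length_eq) (simp_all add: wp_length)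
    ultimately have "P @ ?G \<sim> dpow (2 * q) @ ?G" by (blast intro: peq_trans peq_sym)
    then show False using peq_cancelR[OF lists(2)] P(3) by blast
  qed
  moreover have "length ?G' \<le> length (P @ ?G)" using dv_length[OF dec] P(2) by (simp add: wp_length)
  ultimately have "length ?G' < length (P @ ?G)" by linarith
  with Suc P(2) show ?case by simp
qed simp

text \<open>The prefix \<open>u\<close> serves the induction: each step of the recursion passes one
  \<open>P\<close> into it.\<close>

lemma dv_orbit_meet:
  assumes P: "P \<in> lists S"
  shows "u \<in> lists S \<Longrightarrow> (\<And>i. i \<le> k \<Longrightarrow> h \<unlhd> u @ wp P i @ dpow (2 * (q * (k - i)))) \<Longrightarrow> h \<unlhd> u @ orbit_meet P q k"
proof (induction k arbitrary: u)
  case 0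
  then show ?case using "0.prems"(2)[of 0] by simp
next
  case (Suc k)
  have lists: "P @ orbit_meet P q k \<in> lists S" using P orbit_meet_lists by simp
  have "h \<unlhd> u @ dpow (2 * (q * Suc k))" using Suc.prems(2)[of 0] by simp
  moreover have "h \<unlhd> u @ P @ orbit_meet P q k"
  proof -
    have "h \<unlhd> (u @ P) @ orbit_meet P q k"
    proof (rule Suc.IH)
      show "u @ P \<in> lists S" using P Suc.prems(1) by simp
      show "h \<unlhd> (u @ P) @ wp P i @ dpow (2 * (q * (k - i)))" if "i \<le> k" for i
        using Suc.prems(2)[of "Suc i"] that by simp
    qed
    then show ?thesis by simp
  qed
  ultimately show ?case using dv_append_lgcd[OF Suc.prems(1) dpow_lists lists] by simp
qed

lemma nrm_power_growth:
  assumes P: "P \<in> lists S" "length P = 2 * q * length d" "\<not> P \<sim> dpow (2 * q)"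
  shows "\<exists>i\<le>k. nrm (wp P i) \<ge> k"
proof -
  have lists: "wp P i \<in> lists S" for i using P(1) by (rule wp_lists)
  \<comment> \<open>For i \<le> k this is the exponent of \<Delta> in c^i scaled by the common
    factor \<Delta>^(2qk). A norm is large exactly when this exponent is small.\<close>
  define E where "E i = inf_exp (wp P i) + 2 * (q * (k - i))" for i
  have E: "nrm (wp P i) + E i * length d = 2 * q * length d * k" if i: "i \<le> k" for i
  proof -
    have "nrm (wp P i) + inf_exp (wp P i) * length d = i * (2 * q * length d)"
      using nrm_inf_exp[OF lists, of i] by (simp add: wp_length P(2))
    moreover obtain j where "k = i + j" using le_Suc_ex[OF i] by blast
    ultimately show ?thesis by (simp add: E_def algebra_simps)
  qed
  \<comment> \<open>With the least exponent, \<Delta>^(E i) divides all the scaled powers of c and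
    therefore their meet, whose length is bounded by \<open>orbit_meet_length\<close>.\<close>
  obtain i where i: "i \<le> k" "\<And>j. j \<le> k \<Longrightarrow> E i \<le> E j"
  proof -
    have "Min (E ` {..k}) \<in> E ` {..k}" by (intro Min_in) auto
    then obtain i where "Min (E ` {..k}) = E i" "i \<in> {..k}" by (rule imageE)
    moreover have "Min (E ` {..k}) \<le> E j" if "j \<le> k" for j using that by (intro Min_le) auto
    ultimately show ?thesis using that[of i] by simp
  qed
  have "dpow (E i) \<unlhd> [] @ orbit_meet P q k"
  proof (rule dv_orbit_meet[OF P(1)])
    fix j assume j: "j \<le> k"
    obtain z where z: "z \<in> lists S" "dpow (inf_exp (wp P j)) @ z \<sim> wp P j"
      using dpow_inf_exp[OF lists] by (auto simp: dv_def)
    let ?D = "dpow (2 * (q * (k - j)))"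
    have "dpow (E i) \<unlhd> dpow (E j)" using i(2)[OF j] by (rule dpow_mono)
    also have "dpow (E j) \<unlhd> dpow (E j) @ z" using z(1) by simp
    also have "dpow (E j) @ z = dpow (inf_exp (wp P j)) @ ?D @ z" unfolding E_def wp_add by simp
    also have "dpow (inf_exp (wp P j)) @ ?D @ z \<unlhd> dpow (inf_exp (wp P j)) @ z @ ?D"
      using peq_appendL[OF peq_sym[OF dpow_central[OF z(1)]]] by (rule peq_imp_dv)
    also have "dpow (inf_exp (wp P j)) @ z @ ?D \<unlhd> wp P j @ ?D"
      using peq_appendR[OF z(2), of ?D] by (intro peq_imp_dv) simp
    finally show "dpow (E i) \<unlhd> [] @ wp P j @ ?D" by simp
  qed simp
  then have "E i * length d \<le> length (orbit_meet P q k)"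
    using dv_length[of "dpow (E i)" "orbit_meet P q k"] by (simp add: wp_length)
  with orbit_meet_length[OF P, of k] E[OF i(1)] have "nrm (wp P i) \<ge> k" by linarith
  with i(1) show ?thesis by blast
qed

theorem translation_length_bound:
  assumes a: "a \<in> awords S" and inf: "infinite_order_G S m d a"
  shows "translation_length S m d a \<ge> 1 / (2 * real (length d))"
proof -
  define p q where "p = clear a" and "q = negs a"
  have p: "p \<in> lists S" using clear_lists[OF a] by (simp add: p_def)
  have power: "wp a n @ pos (dpow (2 * (q * n))) \<simeq> pos (wp p n)" for n
  proof (induction n)
    case (Suc n)
    have "dpow (2 * (q * Suc n)) = dpow (2 * (q * n)) @ dpow (2 * q)"
      unfolding wp_add[symmetric] by (simp add: algebra_simps)
    then have "wp a (Suc n) @ pos (dpow (2 * (q * Suc n))) =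
        a @ (wp a n @ pos (dpow (2 * (q * n)))) @ pos (dpow (2 * q))" by simp
    also have "\<dots> \<simeq> a @ pos (wp p n) @ pos (dpow (2 * q))" using Suc by (rule aeq_context)
    also have "a @ pos (wp p n) @ pos (dpow (2 * q)) \<simeq> a @ pos (dpow (2 * q) @ wp p n)"
      using aeq_appendL[OF peq_aeq[OF dpow_central[OF wp_lists[OF p]]]] by simp
    also have "a @ pos (dpow (2 * q) @ wp p n) \<simeq> pos (wp p (Suc n))"
      using aeq_appendR[OF clear_aeq[OF a], of "pos (wp p n)"] by (simp add: p_def q_def)
    finally show ?case .
  qed (simp add: artin_eq.refl)
  define f where "f n = nrm (wp p n)" for n
  have norm: "wordnorm S m d (wp a n) = f n" for n
    using wordnorm_eq_nrm[OF wp_lists[OF p] power] by (simp add: f_def)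
  \<comment> \<open>With this exponent the word p^r has the length of \<Delta>^(2 length p), so
    their quotient c has degree 0.\<close>
  define r where "r = 2 * length d"
  have r: "r > 0" using Delta_nontrivial by (simp add: r_def)
  have no_power: "\<not> wp p r \<sim> dpow (2 * length p)"
  proof
    assume "wp p r \<sim> dpow (2 * length p)"
    with power[of r] have "wp a r @ pos (dpow (2 * (q * r))) \<simeq> [] @ pos (dpow (2 * length p))"
      using peq_aeq by (auto intro: artin_eq.trans)
    \<comment> \<open>Every exponent of \<Delta> involved is even, so this equation would place a
      power of \<open>a\<close> in the subgroup generated by \<Delta>^2.\<close>
    from wpow_of_shift[OF this] have "wp a r \<simeq> wpow (pos d) (2 * (int (length p) - int (q * r)))"
      by (simp add: algebra_simps)
    then show False using inf r unfolding infinite_order_G_def by blast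
  qed
  have growth: "\<exists>i\<le>k. f (r * i) \<ge> k" for k
    using nrm_power_growth[of "wp p r" "length p" k] no_power wp_lists[OF p, of r]
    by (simp add: f_def wp_wp wp_length r_def)
  have "f (i + j) \<le> f i + f j" for i j
    using nrm_subadditive[OF wp_lists[OF p] wp_lists[OF p]] by (simp add: f_def wp_add)
  then obtain L where L: "(\<lambda>n. real (f n) / real n) \<longlonglongrightarrow> L" using fekete[of f] by blast
  then have "translation_length S m d a = L" unfolding translation_length_def norm by (rule limI)
  then show ?thesis using lim_ge_of_frequent_growth[OF L r growth] by (simp add: r_def)
qed

end

end

theorem theorem4p1:
  fixes S :: "'a set" and m :: "'a \<Rightarrow> 'a \<Rightarrow> nat" and d :: "'a list"
    and a :: "('a \<times> bool) list"
  assumes "finite S" and "coxeter_matrix S m" and "finite_type S m"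
    and "is_Delta S m d"
    and "a \<in> awords S"
    and "infinite_order_G S m d a"
  shows "translation_length S m d a \<ge> 1 / (2 * real (length d))"
proof -
  interpret finite_type_coxeter S m d
    using assms by unfold_locales
  show ?thesis
  proof (cases "d = []")
    \<comment> \<open>Every letter divides \<Delta>, so an empty \<Delta> leaves no letters. Then
      \<open>a\<close> is the empty word, whose first power is already trivial, against its infinite
      order.\<close>
    case True
    have "S = {}"
    proof (rule ccontr)
      assume "S \<noteq> {}"
      then obtain s where "s \<in> S" by blast
      then have "[s] \<unlhd> d" by (rule letter_dv_Delta)
      then show False using dv_length True by fastforce
    qed
    then have "concat (replicate 1 a) \<simeq> wpow (pos d) (2 * 0)"
      using assms(5) True by (cases a) (auto simp: awords_def wpow_def artin_eq.refl)
    moreover have "\<not> concat (replicate 1 a) \<simeq> wpow (pos d) (2 * 0)"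
      using assms(6)[unfolded infinite_order_G_def, rule_format, OF zero_less_one] .
    ultimately show ?thesis by (rule notE[rotated])
  next
    case False
    then show ?thesis using assms(5,6) by (rule translation_length_bound)
  qed
qed

end
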